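(* Let $\mathbb F$ be an algebraically closed field of characteristic $p>2$, let $m,n,t\ge1$, and let $\lambda\in(\mathbb F^\times)^m$, $\kappa\in(\mathbb F^\times)^n$ satisfy $\lambda_1^{p-1}=\cdots=\lambda_m^{p-1}=\kappa_1^{p-1}=\cdots=\kappa_n^{p-1}$. Let $\mathfrak h=\mathfrak h^{\lambda,\kappa,\mu}_{m,n,t}$ be the twisted Heisenberg Lie superalgebra, with basis $\{e_1,\dots,e_{2m+2}\mid\omega_1,\dots,\omega_{2n},\eta_1,\dots,\eta_t\}$. Then, for the ordinary (Chevalley–Eilenberg) cohomology with trivial coefficients: (1) $H^1(\mathfrak h)$ is spanned by the classes of the cocycles $\{e^{2m+2}\mid\eta^1,\dots,\eta^t\}$. (2) $H^2(\mathfrak h)$ is spanned by the classes of the cocycles in $\bigcup_{i=1}^5A_i$, where $$A_1=\{\delta_{\lambda_i=\pm\lambda_j}(e^{i,j}-\lambda_i\lambda_j^{-1}e^{m+i,m+j}),\ \delta_{\lambda_i=\pm\lambda_j}(e^{i,m+j}+\lambda_i\lambda_j^{-1}e^{j,m+i})\mid 1\le i\le j\le m\},$$ $$A_2=\{\delta_{\lambda_i=\pm\kappa_j}(e^{m+i}\wedge\omega^j-\lambda_i\kappa_j^{-1}e^i\wedge\omega^{n+j}),\ \delta_{\lambda_i=\pm\kappa_j}(e^i\wedge\omega^j-\lambda_i\kappa_j^{-1}e^{m+i}\wedge\omega^{n+j})\mid 1\le i\le m,\ 1\le j\le n\},$$ $$A_3=\{\delta_{\kappa_i=\pm\kappa_j}(\omega^{i,j}-\kappa_i\kappa_j^{-1}\omega^{n+i,n+j}),\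 \delta_{\kappa_i=\pm\kappa_j}(\omega^{i,n+j}-\kappa_i\kappa_j^{-1}\omega^{j,n+i})\mid 1\le i\le j\le n\},$$ $$A_4=\{\eta^{i,i},\ \eta^{k,l}\mid 1\le i\le t-1,\ 1\le k<l\le t\},$$ $$A_5=\{e^{2m+2}\wedge\eta^k\mid 1\le k\le t\}.$$ In particular, $\mathrm{sdim}\,H^2(\mathfrak h)=(d_0,d_1)$ with $$d_0=2\,\mathrm{Card}\{(i,j)\mid\lambda_i=\pm\lambda_j,\ 1\le i<j\le m\}+2\,\mathrm{Card}\{(i,j)\mid\kappa_i=\pm\kappa_j,\ 1\le i\le j\le n\}+\tfrac{t(t+1)}2+m-1,$$ $$d_1=2\,\mathrm{Card}\{(i,j)\mid\lambda_i=\pm\kappa_j,\ 1\le i\le m,\ 1\le j\le n\}+t.$$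
   Context: The twisted Heisenberg Lie superalgebra $\mathfrak h^{\lambda,\kappa}_{m,n,t}$ is the superspace over $\mathbb F$ of superdimension $(2m+2,2n+t)$ with even basis $e_1,\dots,e_{2m+2}$ and odd basis $\omega_1,\dots,\omega_{2n},\eta_1,\dots,\eta_t$, whose non-vanishing brackets (up to super-skew-symmetry) are $$[e_i,e_{m+i}]=[\omega_j,\omega_j]=-[\omega_{n+j},\omega_{n+j}]=[\eta_k,\eta_k]=e_{2m+1},$$ $$[e_{2m+2},e_i]=\lambda_i e_{m+i},\quad [e_{2m+2},e_{m+i}]=\lambda_i e_i,\quad [e_{2m+2},\omega_j]=\kappa_j\omega_{n+j},\quad [e_{2m+2},\omega_{n+j}]=\kappa_j\omega_j,$$ for $1\le i\le m$, $1\le j\le n$, $1\le k\le t$. Under the stated hypotheses it carries restricted structures, and $\mathfrak h^{\lambda,\kappa,\mu}_{m,n,t}$ denotes it equipped with the restricted structure with parameter $\mu=(\mu_1,\dots,\mu_{2m+2})\in\mathbb F^{2m+2}$, namely $e_i^{[p]}=\mu_ie_{2m+1}$ for $1\le i\le 2m+1$ and $e_{2m+2}^{[p]}=|\lambda|e_{2m+2}+\mu_{2m+2}e_{2m+1}$, where $|\lambda|$ is the common value of $\lambda_i^{p-1}=\kappa_j^{p-1}$; the ordinary cohomology does not involve $\mu$. Cohomology: for a finite-dimensional Lie superalgebra $\mathfrak g$, $C^0(\mathfrak g)=\mathbb F$ and $C^q(\mathfrak g)=\wedge^q\mathfrak g^*$ (super exterior power, viewed as linear forms on $\wedge^q\mathfrak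 g$), $q=1,2,3$. The differentials are $d^0=0$, $d^1(\psi)(g\wedge h)=\psi([g,h])$ and $$d^2(\varphi)(g\wedge h\wedge f)=\varphi([g,h]\wedge f)-(-1)^{|f||h|}\varphi([g,f]\wedge h)+(-1)^{|g|(|h|+|f|)}\varphi([h,f]\wedge g);$$ $H^q(\mathfrak g)=\ker d^q/\mathrm{im}\,d^{q-1}$ for $q=1,2$. Notation: $e^i,\omega^j,\eta^k$ are the dual basis vectors; $e^{i,j}$, $\omega^{i,j}$, $\eta^{k,l}$, $e^i\wedge\omega^j$, $e^i\wedge\eta^k$ denote the dual vectors of $e_i\wedge e_j$, $\omega_i\wedge\omega_j$, $\eta_k\wedge\eta_l$, $e_i\wedge\omega_j$, $e_i\wedge\eta_k$ in $\wedge^2\mathfrak g$ (here $e_i\wedge e_j=-e_j\wedge e_i$, so $e^{i,i}=0$, while $\omega_i\wedge\omega_j=\omega_j\wedge\omega_i$ and $\eta_k\wedge\eta_l=\eta_l\wedge\eta_k$). For a proposition $P$, $\delta_P=1$ if $P$ is true and $\delta_P=0$ otherwise; "$x=\pm y$" means $x=y$ or $x=-y$. For a superspace $V$, $\mathrm{sdim}\,V=(\dim V_{\bar0},\dim V_{\bar1})$. In a list $\{\dots\mid\dots\}$ of basis vectors, even elements precede the bar and odd ones follow it.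
   Formalization: The even dimension d_0 is corrected to the printed expression minus n: for i=j the second form in A_3 is zero, so each diagonal pair contributes one class, not two (for m=n=t=1 the printed d_0 is 3 but the listed even classes span dimension at most 2). *)

theory Defs
  imports "Jordan_Normal_Form.VS_Connect"
begin

section \<open>Lie superalgebras with a homogeneous basis\<close>

text \<open>
  The underlying superspace of \<open>G\<close> is the set of coordinate vectors supported on the finite set
  \<open>base G\<close> of homogeneous basis elements; \<open>deg G b\<close> is the parity (0 or 1) of the basis element \<open>b\<close>.
\<close>

record ('b, 'a) based_superalgebra =
  base :: "'b set"
  deg :: "'b \<Rightarrow> nat"
  bracket :: "('b \<Rightarrow> 'a) \<Rightarrow> ('b \<Rightarrow> 'a) \<Rightarrow> ('b \<Rightarrow> 'a)"

definition vecs :: "('b, 'a::field) based_superalgebra \<Rightarrow> ('b \<Rightarrow> 'a) set" where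
  "vecs G = {x. \<forall>b. b \<notin> base G \<longrightarrow> x b = 0}"

definition hom_vecs :: "('b, 'a::field) based_superalgebra \<Rightarrow> nat \<Rightarrow> ('b \<Rightarrow> 'a) set" where
  "hom_vecs G a = {x \<in> vecs G. \<forall>b. x b \<noteq> 0 \<longrightarrow> deg G b = a}"

definition hcomp :: "('b, 'a::field) based_superalgebra \<Rightarrow> nat \<Rightarrow> ('b \<Rightarrow> 'a) \<Rightarrow> ('b \<Rightarrow> 'a)" where
  "hcomp G a x = (\<lambda>b. if deg G b = a then x b else 0)"

section \<open>Cochains and differentials with trivial coefficients\<close>

text \<open>
  By the universal property of the super exterior power, a linear form on it is the same thing as a
  multilinear form that is super-skew-symmetric on homogeneous arguments. Forms are set to 0 outside
  the superspace, so that equality of forms is equality of functions.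
\<close>

definition linear_form_on :: "('b \<Rightarrow> 'a::field) set \<Rightarrow> (('b \<Rightarrow> 'a) \<Rightarrow> 'a) \<Rightarrow> bool" where
  "linear_form_on V f \<longleftrightarrow>
     (\<forall>x\<in>V. \<forall>y\<in>V. \<forall>c d. f (\<lambda>b. c * x b + d * y b) = c * f x + d * f y)"

definition cochains1 :: "('b, 'a::field) based_superalgebra \<Rightarrow> (('b \<Rightarrow> 'a) \<Rightarrow> 'a) set" where
  "cochains1 G = {\<psi>. linear_form_on (vecs G) \<psi> \<and> (\<forall>x. x \<notin> vecs G \<longrightarrow> \<psi> x = 0)}"

definition cochains2 ::
  "('b, 'a::field) based_superalgebra \<Rightarrow> (('b \<Rightarrow> 'a) \<times> ('b \<Rightarrow> 'a) \<Rightarrow> 'a) set" where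
  "cochains2 G = {\<phi>.
     (\<forall>y\<in>vecs G. linear_form_on (vecs G) (\<lambda>x. \<phi> (x, y))) \<and>
     (\<forall>x\<in>vecs G. linear_form_on (vecs G) (\<lambda>y. \<phi> (x, y))) \<and>
     (\<forall>x y. x \<notin> vecs G \<or> y \<notin> vecs G \<longrightarrow> \<phi> (x, y) = 0) \<and>
     (\<forall>a\<in>{0,1}. \<forall>b\<in>{0,1}. \<forall>x\<in>hom_vecs G a. \<forall>y\<in>hom_vecs G b.
        \<phi> (x, y) = - ((-1) ^ (a * b) * \<phi> (y, x)))}"

definition d0 :: "('b, 'a::field) based_superalgebra \<Rightarrow> 'a \<Rightarrow> ('b \<Rightarrow> 'a) \<Rightarrow> 'a" where
  "d0 G c = (\<lambda>x. 0)"

definition d1 :: "('b, 'a::field) based_superalgebra \<Rightarrow> (('b \<Rightarrow> 'a) \<Rightarrow> 'a) \<Rightarrow>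
    ('b \<Rightarrow> 'a) \<times> ('b \<Rightarrow> 'a) \<Rightarrow> 'a" where
  "d1 G \<psi> = (\<lambda>(g, h). if g \<in> vecs G \<and> h \<in> vecs G then \<psi> (bracket G g h) else 0)"

definition d2_hom :: "('b, 'a::field) based_superalgebra \<Rightarrow> (('b \<Rightarrow> 'a) \<times> ('b \<Rightarrow> 'a) \<Rightarrow> 'a) \<Rightarrow>
    nat \<Rightarrow> nat \<Rightarrow> nat \<Rightarrow> ('b \<Rightarrow> 'a) \<Rightarrow> ('b \<Rightarrow> 'a) \<Rightarrow> ('b \<Rightarrow> 'a) \<Rightarrow> 'a" where
  "d2_hom G \<phi> pg ph pf g h f =
     \<phi> (bracket G g h, f)
     - (-1) ^ (pf * ph) * \<phi> (bracket G g f, h)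
     + (-1) ^ (pg * (ph + pf)) * \<phi> (bracket G h f, g)"

text \<open>The sign rule is stated for homogeneous arguments of parities \<open>pg\<close>, \<open>ph\<close>, \<open>pf\<close>; \<open>d2\<close> is its
  trilinear extension through homogeneous components.\<close>

definition d2 :: "('b, 'a::field) based_superalgebra \<Rightarrow> (('b \<Rightarrow> 'a) \<times> ('b \<Rightarrow> 'a) \<Rightarrow> 'a) \<Rightarrow>
    ('b \<Rightarrow> 'a) \<times> ('b \<Rightarrow> 'a) \<times> ('b \<Rightarrow> 'a) \<Rightarrow> 'a" where
  "d2 G \<phi> = (\<lambda>(g, h, f).
     if g \<in> vecs G \<and> h \<in> vecs G \<and> f \<in> vecs G
     then \<Sum>pg\<in>{0,1}. \<Sum>ph\<in>{0,1}. \<Sum>pf\<in>{0,1}.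
            d2_hom G \<phi> pg ph pf (hcomp G pg g) (hcomp G ph h) (hcomp G pf f)
     else 0)"

definition cocycles1 :: "('b, 'a::field) based_superalgebra \<Rightarrow> (('b \<Rightarrow> 'a) \<Rightarrow> 'a) set" where
  "cocycles1 G = {\<psi> \<in> cochains1 G. d1 G \<psi> = (\<lambda>_. 0)}"

definition coboundaries1 :: "('b, 'a::field) based_superalgebra \<Rightarrow> (('b \<Rightarrow> 'a) \<Rightarrow> 'a) set" where
  "coboundaries1 G = range (d0 G)"

definition cocycles2 ::
  "('b, 'a::field) based_superalgebra \<Rightarrow> (('b \<Rightarrow> 'a) \<times> ('b \<Rightarrow> 'a) \<Rightarrow> 'a) set" where
  "cocycles2 G = {\<phi> \<in> cochains2 G. d2 G \<phi> = (\<lambda>_. 0)}"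

definition coboundaries2 ::
  "('b, 'a::field) based_superalgebra \<Rightarrow> (('b \<Rightarrow> 'a) \<times> ('b \<Rightarrow> 'a) \<Rightarrow> 'a) set" where
  "coboundaries2 G = d1 G ` cochains1 G"

text \<open>Forms of parity \<open>s\<close> vanish on homogeneous arguments whose total parity differs from \<open>s\<close>.\<close>

definition parity1 :: "('b, 'a::field) based_superalgebra \<Rightarrow> nat \<Rightarrow> (('b \<Rightarrow> 'a) \<Rightarrow> 'a) set" where
  "parity1 G s = {\<psi>. \<forall>a\<in>{0,1}. a \<noteq> s \<longrightarrow> (\<forall>x\<in>hom_vecs G a. \<psi> x = 0)}"

definition parity2 ::
  "('b, 'a::field) based_superalgebra \<Rightarrow> nat \<Rightarrow> (('b \<Rightarrow> 'a) \<times> ('b \<Rightarrow> 'a) \<Rightarrow> 'a) set" where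
  "parity2 G s = {\<phi>. \<forall>a\<in>{0,1}. \<forall>b\<in>{0,1}. (a + b) mod 2 \<noteq> s \<longrightarrow>
     (\<forall>x\<in>hom_vecs G a. \<forall>y\<in>hom_vecs G b. \<phi> (x, y) = 0)}"

section \<open>Cohomology\<close>

definition coset :: "('x \<Rightarrow> 'a::field) set \<Rightarrow> ('x \<Rightarrow> 'a) \<Rightarrow> ('x \<Rightarrow> 'a) set" where
  "coset B f = {\<lambda>z. f z + b z | b. b \<in> B}"

text \<open>The space of cosets of \<open>B\<close> with representatives in \<open>Z\<close>, that is, \<open>(Z + B) / B\<close>. The ring fields
  \<open>mult\<close> and \<open>one\<close> of the record are not used for modules.\<close>

definition quotient_space ::
  "('x \<Rightarrow> 'a::field) set \<Rightarrow> ('x \<Rightarrow> 'a) set \<Rightarrow> ('a, ('x \<Rightarrow> 'a) set) module" where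
  "quotient_space Z B =
     \<lparr>carrier = coset B ` Z, mult = undefined, one = undefined, zero = B,
      add = (\<lambda>X Y. {\<lambda>z. f z + g z | f g. f \<in> X \<and> g \<in> Y}),
      smult = (\<lambda>c X. {\<lambda>z. c * f z + b z | f b. f \<in> X \<and> b \<in> B})\<rparr>"

definition H1 where
  "H1 G = quotient_space (cocycles1 G) (coboundaries1 G)"

definition H2 where
  "H2 G = quotient_space (cocycles2 G) (coboundaries2 G)"

definition H2_part where
  "H2_part G s = quotient_space (cocycles2 G \<inter> parity2 G s) (coboundaries2 G)"

definition sdim_H2 :: "('b, 'a::field) based_superalgebra \<Rightarrow> nat \<times> nat" where
  "sdim_H2 G = (vectorspace.dim class_ring (H2_part G 0), vectorspace.dim class_ring (H2_part G 1))"

section \<open>Dual basis forms\<close>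

definition dual1 :: "('b, 'a::field) based_superalgebra \<Rightarrow> 'b \<Rightarrow> ('b \<Rightarrow> 'a) \<Rightarrow> 'a" where
  "dual1 G b = (\<lambda>x. if x \<in> vecs G then x b else 0)"

text \<open>The linear form on the super exterior square that is dual to the wedge of the basis elements
  \<open>a\<close> and \<open>b\<close>. That wedge is 0 when \<open>a = b\<close> is even; when \<open>a = b\<close> is odd the form takes the value 1
  (not 2) at it.\<close>

definition dual2 :: "('b, 'a::field) based_superalgebra \<Rightarrow> 'b \<Rightarrow> 'b \<Rightarrow>
    ('b \<Rightarrow> 'a) \<times> ('b \<Rightarrow> 'a) \<Rightarrow> 'a" where
  "dual2 G a b = (\<lambda>(x, y).
     if x \<in> vecs G \<and> y \<in> vecs G
     then if a = b then (if deg G a = 1 then x a * y a else 0)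
          else x a * y b - (-1) ^ (deg G a * deg G b) * (x b * y a)
     else 0)"

section \<open>The twisted Heisenberg Lie superalgebra\<close>

datatype hidx = Ev nat | Om nat | Et nat

fun hdeg :: "hidx \<Rightarrow> nat" where
  "hdeg (Ev i) = 0"
| "hdeg (Om j) = 1"
| "hdeg (Et k) = 1"

definition hbase :: "nat \<Rightarrow> nat \<Rightarrow> nat \<Rightarrow> hidx set" where
  "hbase m n t = Ev ` {1..2*m+2} \<union> Om ` {1..2*n} \<union> Et ` {1..t}"

definition sbv :: "'a::field \<Rightarrow> hidx \<Rightarrow> (hidx \<Rightarrow> 'a)" where
  "sbv c b = (\<lambda>k. if k = b then c else 0)"

text \<open>The listed brackets, each in one order of its two arguments only; all other values are 0.\<close>

fun listed :: "nat \<Rightarrow> nat \<Rightarrow> (nat \<Rightarrow> 'a::field) \<Rightarrow> (nat \<Rightarrow> 'a) \<Rightarrow> hidx \<Rightarrow> hidx \<Rightarrow> (hidx \<Rightarrow> 'a)" where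
  "listed m n lam kap (Ev i) (Ev j) =
     (if i \<in> {1..m} \<and> j = m + i then sbv 1 (Ev (2*m+1))
      else if i = 2*m+2 \<and> j \<in> {1..m} then sbv (lam j) (Ev (m+j))
      else if i = 2*m+2 \<and> j \<in> {m+1..2*m} then sbv (lam (j-m)) (Ev (j-m))
      else (\<lambda>_. 0))"
| "listed m n lam kap (Om i) (Om j) =
     (if i = j \<and> j \<in> {1..n} then sbv 1 (Ev (2*m+1))
      else if i = j \<and> j \<in> {n+1..2*n} then sbv (-1) (Ev (2*m+1))
      else (\<lambda>_. 0))"
| "listed m n lam kap (Et k) (Et l) = (if k = l then sbv 1 (Ev (2*m+1)) else (\<lambda>_. 0))"
| "listed m n lam kap (Ev i) (Om j) =
     (if i = 2*m+2 \<and> j \<in> {1..n} then sbv (kap j) (Om (n+j))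
      else if i = 2*m+2 \<and> j \<in> {n+1..2*n} then sbv (kap (j-n)) (Om (j-n))
      else (\<lambda>_. 0))"
| "listed m n lam kap _ _ = (\<lambda>_. 0)"

definition hstruct :: "nat \<Rightarrow> nat \<Rightarrow> (nat \<Rightarrow> 'a::field) \<Rightarrow> (nat \<Rightarrow> 'a) \<Rightarrow>
    hidx \<Rightarrow> hidx \<Rightarrow> (hidx \<Rightarrow> 'a)" where
  "hstruct m n lam kap a b =
     (if a = b then listed m n lam kap a a
      else (\<lambda>c. listed m n lam kap a b c - (-1) ^ (hdeg a * hdeg b) * listed m n lam kap b a c))"

definition twisted_heisenberg :: "nat \<Rightarrow> nat \<Rightarrow> nat \<Rightarrow> (nat \<Rightarrow> 'a::field) \<Rightarrow> (nat \<Rightarrow> 'a) \<Rightarrow>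
    (hidx, 'a) based_superalgebra" where
  "twisted_heisenberg m n t lam kap =
     \<lparr>base = hbase m n t, deg = hdeg,
      bracket = (\<lambda>x y c. \<Sum>a\<in>hbase m n t. \<Sum>b\<in>hbase m n t.
                   x a * y b * hstruct m n lam kap a b c)\<rparr>"

section \<open>The cocycles in degree two\<close>

definition eq_pm :: "'a::field \<Rightarrow> 'a \<Rightarrow> bool" where
  "eq_pm x y \<longleftrightarrow> x = y \<or> x = - y"

definition A1 where
  "A1 G m lam = (\<Union>i\<in>{1..m}. \<Union>j\<in>{i..m}.
     {\<lambda>z. of_bool (eq_pm (lam i) (lam j)) *
          (dual2 G (Ev i) (Ev j) z - lam i / lam j * dual2 G (Ev (m+i)) (Ev (m+j)) z),
      \<lambda>z. of_bool (eq_pm (lam i) (lam j)) *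
          (dual2 G (Ev i) (Ev (m+j)) z + lam i / lam j * dual2 G (Ev j) (Ev (m+i)) z)})"

definition A2 where
  "A2 G m n lam kap = (\<Union>i\<in>{1..m}. \<Union>j\<in>{1..n}.
     {\<lambda>z. of_bool (eq_pm (lam i) (kap j)) *
          (dual2 G (Ev (m+i)) (Om j) z - lam i / kap j * dual2 G (Ev i) (Om (n+j)) z),
      \<lambda>z. of_bool (eq_pm (lam i) (kap j)) *
          (dual2 G (Ev i) (Om j) z - lam i / kap j * dual2 G (Ev (m+i)) (Om (n+j)) z)})"

text \<open>For \<open>i = j\<close> the second form of \<open>A3\<close> is identically 0, so a diagonal pair contributes one
  nonzero form, not two.\<close>

definition A3 where
  "A3 G n kap = (\<Union>i\<in>{1..n}. \<Union>j\<in>{i..n}.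
     {\<lambda>z. of_bool (eq_pm (kap i) (kap j)) *
          (dual2 G (Om i) (Om j) z - kap i / kap j * dual2 G (Om (n+i)) (Om (n+j)) z),
      \<lambda>z. of_bool (eq_pm (kap i) (kap j)) *
          (dual2 G (Om i) (Om (n+j)) z - kap i / kap j * dual2 G (Om j) (Om (n+i)) z)})"

definition A4 where
  "A4 G t = {dual2 G (Et i) (Et i) | i. 1 \<le> i \<and> i \<le> t - 1} \<union>
            {dual2 G (Et k) (Et l) | k l. 1 \<le> k \<and> k < l \<and> l \<le> t}"

definition A5 where
  "A5 G m t = {dual2 G (Ev (2*m+2)) (Et k) | k. 1 \<le> k \<and> k \<le> t}"

end

(*
  Let z = e_(2m+1), D = e_(2m+2), and let V be spanned by the remaining basis vectors. Since V
  contains two vectors with bracket z that are orthogonal to any given third one, a 2-cocycle kills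
  z, and the cocycle condition becomes invariance of its restriction to V under ad D; its values on
  D and V are unconstrained. Coboundaries are the multiples of the form [.,.] on V together with
  everything on D and [D,V], so the class is determined by an invariant form modulo one line.
  Now ad D swaps a basis vector b with a partner sg b up to the weight wt b, hence an invariant form
  is determined on the orbit of (a, b) by its value at (a, b), and that value vanishes unless
  wt a = wt b or wt a = - wt b. One pivot per orbit then gives a basis of H^2 that is dual to
  evaluation at the pivots; the pair (eta_t, eta_t) is sacrificed to the line of coboundaries.
*)


theory Submission
  imports Defs
begin

section \<open>Bases of quotients of function spaces\<close>

text \<open>Write x = wt a, y = wt b, and let u, v be the values of an invariant form at (a, b) and
  (sg a, sg b). Invariance at (a, sg b) and (sg a, b) gives x v + y u = 0 and x u + y v = 0. The
  determinant is x^2 - y^2 up to sign; when it vanishes and the weights are nonzero, v = -(x / y) u,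
  which is the coefficient lambda_i / lambda_j, lambda_i / kappa_j or kappa_i / kappa_j in the forms
  of the theorem. The obstacle is the short orbits, where symmetry of the form ties u to v or to
  itself. An even vector paired with itself carries nothing. At (omega_j, omega_(n+j)) symmetry
  gives u = v, so 2 x u = 0 and nothing survives, whereas at (e_i, e_(m+i)) skewness makes the two
  terms of the form add up to a factor 2. Both use that 2 is invertible, and this asymmetry decides
  which diagonal pairs are counted in the even dimension. The pairs (D, eta_k) survive because ad D
  kills eta_k, so every coboundary is zero there. The pair (eta_t, eta_t) can absorb the coboundary
  line because [eta_t, eta_t] = z.\<close>

definition lin_closed :: "('x \<Rightarrow> 'a::field) set \<Rightarrow> bool" where
  "lin_closed S \<longleftrightarrow> (\<lambda>_. 0) \<in> S \<and> (\<forall>c. \<forall>f\<in>S. \<forall>g\<in>S. (\<lambda>z. c * f z + g z) \<in> S)"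

lemma lin_closedD:
  assumes "lin_closed S"
  shows lin_closed_zero: "(\<lambda>_. 0) \<in> S"
    and lin_closed_axpy: "f \<in> S \<Longrightarrow> g \<in> S \<Longrightarrow> (\<lambda>z. c * f z + g z) \<in> S"
    and lin_closed_scale: "f \<in> S \<Longrightarrow> (\<lambda>z. c * f z) \<in> S"
    and lin_closed_add: "f \<in> S \<Longrightarrow> g \<in> S \<Longrightarrow> (\<lambda>z. f z + g z) \<in> S"
    and lin_closed_diff: "f \<in> S \<Longrightarrow> g \<in> S \<Longrightarrow> (\<lambda>z. f z - g z) \<in> S"
proof -
  show z: "(\<lambda>_. 0) \<in> S" using assms by (auto simp: lin_closed_def)
  show ax: "f \<in> S \<Longrightarrow> g \<in> S \<Longrightarrow> (\<lambda>z. c * f z + g z) \<in> S" for f g c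
    using assms by (auto simp: lin_closed_def)
  show "f \<in> S \<Longrightarrow> (\<lambda>z. c * f z) \<in> S" using ax[of f "\<lambda>_. 0" c] z by simp
  show "f \<in> S \<Longrightarrow> g \<in> S \<Longrightarrow> (\<lambda>z. f z + g z) \<in> S" using ax[of f g 1] by simp
  show "f \<in> S \<Longrightarrow> g \<in> S \<Longrightarrow> (\<lambda>z. f z - g z) \<in> S" using ax[of g f "-1"] by simp
qed

lemma lin_closed_sum:
  assumes "lin_closed S" "finite I" "\<And>i. i \<in> I \<Longrightarrow> F i \<in> S"
  shows "(\<lambda>z. \<Sum>i\<in>I. c i * F i z) \<in> S"
  using assms(2,3)
  by (induction I rule: finite_induct)
    (auto simp: lin_closed_zero[OF assms(1)] intro!: lin_closed_axpy[OF assms(1)])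

lemma lin_closed_Int: "lin_closed S \<Longrightarrow> lin_closed T \<Longrightarrow> lin_closed (S \<inter> T)"
  by (auto simp: lin_closed_def)

text \<open>No inclusion of \<open>B\<close> in \<open>Z\<close> is assumed: for a parity part,
  \<open>Z\<close> holds the cocycles of that parity while \<open>B\<close> holds all
  coboundaries.\<close>

locale quotient =
  fixes Z B :: "('x \<Rightarrow> 'a::field) set"
  assumes Z: "lin_closed Z" and B: "lin_closed B"
begin

abbreviation "Q \<equiv> quotient_space Z B"

lemma coset_eq_iff: "coset B f = coset B g \<longleftrightarrow> (\<lambda>z. f z - g z) \<in> B"
proof
  assume "coset B f = coset B g"
  moreover have "f \<in> coset B f"
    using lin_closed_zero[OF B] by (auto simp: coset_def intro!: exI[of _ "\<lambda>_. 0"])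
  ultimately obtain b where "b \<in> B" "f = (\<lambda>z. g z + b z)" by (auto simp: coset_def)
  thus "(\<lambda>z. f z - g z) \<in> B" by simp
next
  assume d: "(\<lambda>z. f z - g z) \<in> B"
  have "\<exists>b'. (\<lambda>z. f z + b z) = (\<lambda>z. g z + b' z) \<and> b' \<in> B" if "b \<in> B" for b
    by (rule exI[of _ "\<lambda>z. (f z - g z) + b z"]) (use lin_closed_add[OF B d that] in auto)
  moreover have "\<exists>b'. (\<lambda>z. g z + b z) = (\<lambda>z. f z + b' z) \<and> b' \<in> B" if "b \<in> B" for b
    by (rule exI[of _ "\<lambda>z. b z - (f z - g z)"]) (use lin_closed_diff[OF B that d] in auto)
  ultimately show "coset B f = coset B g" by (auto simp: coset_def)
qed

lemma coset_zero: "coset B (\<lambda>_. 0) = B"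
  by (auto simp: coset_def)

lemma add_coset: "add Q (coset B f) (coset B g) = coset B (\<lambda>z. f z + g z)"
proof -
  have "\<exists>b. (\<lambda>z. f z + b1 z + (g z + b2 z)) = (\<lambda>z. f z + g z + b z) \<and> b \<in> B"
    if "b1 \<in> B" "b2 \<in> B" for b1 b2
    by (rule exI[of _ "\<lambda>z. b1 z + b2 z"]) (use lin_closed_add[OF B that] in \<open>auto simp: algebra_simps\<close>)
  moreover have "\<exists>f' g'. (\<lambda>z. f z + g z + b z) = (\<lambda>z. f' z + g' z) \<and>
      (\<exists>b. f' = (\<lambda>z. f z + b z) \<and> b \<in> B) \<and> (\<exists>b. g' = (\<lambda>z. g z + b z) \<and> b \<in> B)" if "b \<in> B" for b
    by (rule exI[of _ f], rule exI[of _ "\<lambda>z. g z + b z"], intro conjI exI[of _ "\<lambda>_. 0"] exI[of _ b])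
      (use that lin_closed_zero[OF B] in auto)
  ultimately show ?thesis by (auto simp: coset_def quotient_space_def)
qed

text \<open>The summand from \<open>B\<close> in the scalar multiple matters at
  \<open>c = 0\<close>, where multiplying representatives alone would leave only the zero function
  instead of the coset \<open>B\<close>.\<close>

lemma smult_coset: "smult Q c (coset B f) = coset B (\<lambda>z. c * f z)"
proof -
  have "\<exists>b. (\<lambda>z. c * (f z + b1 z) + b2 z) = (\<lambda>z. c * f z + b z) \<and> b \<in> B"
    if "b1 \<in> B" "b2 \<in> B" for b1 b2
    by (rule exI[of _ "\<lambda>z. c * b1 z + b2 z"])
      (use lin_closed_axpy[OF B that] in \<open>auto simp: algebra_simps\<close>)
  moreover have "\<exists>f' b'. (\<lambda>z. c * f z + b z) = (\<lambda>z. c * f' z + b' z) \<and>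
      (\<exists>b. f' = (\<lambda>z. f z + b z) \<and> b \<in> B) \<and> b' \<in> B" if "b \<in> B" for b
    by (rule exI[of _ f], rule exI[of _ b])
      (use that lin_closed_zero[OF B] in \<open>auto intro!: exI[of _ "\<lambda>_. 0"]\<close>)
  ultimately show ?thesis by (auto simp: coset_def quotient_space_def)
qed

lemma carrier_Q: "carrier Q = coset B ` Z"
  and zero_Q: "zero Q = coset B (\<lambda>_. 0)"
  by (simp_all add: quotient_space_def coset_zero)

lemma coset_in_carrier: "f \<in> Z \<Longrightarrow> coset B f \<in> carrier Q"
  by (simp add: carrier_Q)

lemma vectorspace_Q: "vectorspace class_ring Q"
proof -
  have "abelian_group Q"
  proof (rule abelian_groupI)
    fix x assume "x \<in> carrier Q"
    then obtain f where f: "f \<in> Z" "x = coset B f" by (auto simp: carrier_Q)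
    show "\<exists>y\<in>carrier Q. y \<oplus>\<^bsub>Q\<^esub> x = \<zero>\<^bsub>Q\<^esub>"
      by (rule bexI[of _ "coset B (\<lambda>z. -1 * f z)"])
        (use f lin_closed_scale[OF Z f(1), of "-1"] in
          \<open>simp_all add: add_coset zero_Q coset_in_carrier\<close>)
  qed (auto simp: carrier_Q zero_Q add_coset ac_simps intro!: imageI lin_closed_add[OF Z]
      lin_closed_zero[OF Z])
  moreover have "cring (class_ring :: 'a ring)" ..
  ultimately have "module class_ring Q"
    by (intro moduleI)
      (auto simp: carrier_Q smult_coset add_coset algebra_simps intro!: imageI lin_closed_scale[OF Z])
  thus ?thesis
    by (simp add: vectorspace_def class_field.field_axioms)
qed

sublocale V: vectorspace class_ring Q
  by (rule vectorspace_Q)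

lemma finsum_coset:
  assumes "finite I" "\<And>i. i \<in> I \<Longrightarrow> F i \<in> Z"
  shows "finsum Q (\<lambda>i. smult Q (c i) (coset B (F i))) I = coset B (\<lambda>z. \<Sum>i\<in>I. c i * F i z)"
  using assms
proof (induction I rule: finite_induct)
  case empty
  show ?case by (simp add: zero_Q)
next
  case (insert i I)
  have "finsum Q (\<lambda>i. smult Q (c i) (coset B (F i))) (insert i I) =
      add Q (smult Q (c i) (coset B (F i))) (finsum Q (\<lambda>i. smult Q (c i) (coset B (F i))) I)"
    using insert by (intro V.finsum_insert)
      (auto simp: smult_coset carrier_Q intro!: imageI lin_closed_scale[OF Z])
  thus ?case using insert by (simp add: smult_coset add_coset)
qed

text \<open>The points of \<open>R\<close> are coordinates on \<open>B\<close>: subtracting the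
  matching element of \<open>B\<close> leaves a representative that vanishes on \<open>R\<close>,
  and no nonzero element of \<open>B\<close> does. These normal forms in \<open>Z\<close> are
  determined by their values at the points \<open>pt i\<close>, to which the \<open>F i\<close> are
  dual up to nonzero scalars.\<close>

lemma basis_by_evaluation:
  assumes fin: "finite I"
    and FZ: "\<And>i. i \<in> I \<Longrightarrow> F i \<in> Z"
    and diag: "\<And>i. i \<in> I \<Longrightarrow> F i (pt i) \<noteq> 0"
    and off: "\<And>i j. i \<in> I \<Longrightarrow> j \<in> I \<Longrightarrow> i \<noteq> j \<Longrightarrow> F i (pt j) = 0"
    and FR: "\<And>i r. i \<in> I \<Longrightarrow> r \<in> R \<Longrightarrow> F i r = 0"
    and uniq: "\<And>f. f \<in> Z \<Longrightarrow> (\<And>i. i \<in> I \<Longrightarrow> f (pt i) = 0) \<Longrightarrow> (\<And>r. r \<in> R \<Longrightarrow> f r = 0)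
        \<Longrightarrow> f = (\<lambda>_. 0)"
    and match: "\<And>f. f \<in> Z \<Longrightarrow> \<exists>b\<in>B \<inter> Z. \<forall>r\<in>R. b r = f r"
    and BR: "\<And>b. b \<in> B \<Longrightarrow> (\<And>r. r \<in> R \<Longrightarrow> b r = 0) \<Longrightarrow> b = (\<lambda>_. 0)"
  shows "V.span (coset B ` F ` I) = carrier Q \<and> V.dim = card I"
proof -
  let ?q = "\<lambda>i. coset B (F i)"
  have eval: "(\<Sum>i\<in>I. c i * F i (pt j)) = c j * F j (pt j)" if "j \<in> I" for c j
  proof -
    have "(\<Sum>i\<in>I. c i * F i (pt j)) = (\<Sum>i\<in>I. if i = j then c j * F j (pt j) else 0)"
      by (rule sum.cong) (use off that in auto)
    thus ?thesis using fin that by simp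
  qed
  have indep: "c j = 0" if "(\<lambda>z. \<Sum>i\<in>I. c i * F i z) \<in> B" "j \<in> I" for c j
  proof -
    have "(\<lambda>z. \<Sum>i\<in>I. c i * F i z) = (\<lambda>_. 0)"
      by (rule BR) (use that FR in auto)
    from fun_cong[OF this, of "pt j"] show ?thesis using eval[OF that(2)] diag[OF that(2)] by simp
  qed
  have inj: "inj_on ?q I"
  proof
    fix i j assume ij: "i \<in> I" "j \<in> I" "?q i = ?q j"
    show "i = j"
    proof (rule ccontr)
      assume ne: "i \<noteq> j"
      \<comment> \<open>Equal classes put \<open>F i - F j\<close> into \<open>B\<close>, a
        combination to which \<open>indep\<close> applies.\<close>
      let ?c = "\<lambda>k. if k = i then 1 else if k = j then -1 else 0 :: 'a"
      have "(\<Sum>k\<in>I. ?c k * F k z) = F i z - F j z" for z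
      proof -
        have "(\<Sum>k\<in>I. ?c k * F k z) =
            (\<Sum>k\<in>I. (if k = i then F i z else 0) - (if k = j then F j z else 0))"
          by (rule sum.cong) (use ne in auto)
        also have "\<dots> = F i z - F j z"
          unfolding sum_subtractf using fin ij(1,2) by simp
        finally show ?thesis .
      qed
      hence "(\<lambda>z. \<Sum>k\<in>I. ?c k * F k z) \<in> B" using ij(3) by (simp add: coset_eq_iff)
      from indep[OF this ij(1)] show False by simp
    qed
  qed
  have sub: "?q ` I \<subseteq> carrier Q" using FZ by (auto simp: carrier_Q)
  have lc: "V.lincomb a (?q ` I) = coset B (\<lambda>z. \<Sum>i\<in>I. a (?q i) * F i z)" for a
  proof -
    have "V.lincomb a (?q ` I) = finsum Q (\<lambda>i. smult Q (a (?q i)) (?q i)) I"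
      unfolding V.lincomb_def using inj FZ
      by (subst V.add.finprod_reindex) (auto simp: smult_coset carrier_Q intro!: imageI lin_closed_scale[OF Z])
    also have "\<dots> = coset B (\<lambda>z. \<Sum>i\<in>I. a (?q i) * F i z)"
      by (rule finsum_coset) (use fin FZ in auto)
    finally show ?thesis .
  qed
  have gen: "V.span (?q ` I) = carrier Q"
  proof
    show "V.span (?q ` I) \<subseteq> carrier Q" by (rule V.span_is_subset2[OF sub])
    show "carrier Q \<subseteq> V.span (?q ` I)"
    proof
      fix x assume "x \<in> carrier Q"
      then obtain f where f: "f \<in> Z" "x = coset B f" by (auto simp: carrier_Q)
      obtain b where b: "b \<in> B" "b \<in> Z" "\<And>r. r \<in> R \<Longrightarrow> b r = f r" using match[OF f(1)] by auto
      \<comment> \<open>The diagonal values are only known to be nonzero: the form belonging to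
        \<open>(Ev i, Ev (m+i))\<close> will take the value 2 at its own pivot.\<close>
      define c where "c i = (f (pt i) - b (pt i)) / F i (pt i)" for i
      let ?s = "\<lambda>z. \<Sum>i\<in>I. c i * F i z"
      have "(\<lambda>z. (f z - b z) - ?s z) = (\<lambda>_. 0)"
      proof (rule uniq)
        show "(\<lambda>z. (f z - b z) - ?s z) \<in> Z"
          by (intro lin_closed_diff[OF Z] lin_closed_sum[OF Z] f b fin FZ)
        show "(f (pt i) - b (pt i)) - ?s (pt i) = 0" if "i \<in> I" for i
          using eval[OF that, of c] diag[OF that] by (simp add: c_def[of i])
        show "(f r - b r) - ?s r = 0" if "r \<in> R" for r
          using b(3)[OF that] FR[OF _ that] by simp
      qed
      hence "(\<lambda>z. f z - ?s z) = b" by (simp add: fun_eq_iff algebra_simps)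
      hence x: "x = coset B ?s" using b(1) f(2) by (simp add: coset_eq_iff)
      \<comment> \<open>Coefficients in \<open>lincomb\<close> are indexed by cosets, so they are
        pulled back to \<open>I\<close> through the injection \<open>?q\<close>.\<close>
      have "x = V.lincomb (\<lambda>X. c (the_inv_into I ?q X)) (?q ` I)"
        unfolding lc x using the_inv_into_f_f[OF inj] by (intro arg_cong[of _ _ "coset B"]) auto
      thus "x \<in> V.span (?q ` I)" using fin by (auto simp: V.span_def class_ring_simps)
    qed
  qed
  have li: "V.lin_indpt (?q ` I)"
  proof
    assume "V.lin_dep (?q ` I)"
    then obtain a v where a: "V.lincomb a (?q ` I) = zero Q" "v \<in> ?q ` I" "a v \<noteq> 0"
      using V.finite_lin_dep[of "?q ` I"] fin sub by (auto simp: class_ring_simps)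
    then obtain j where j: "j \<in> I" "v = ?q j" by auto
    have "(\<lambda>z. \<Sum>i\<in>I. a (?q i) * F i z) \<in> B"
      using a(1) by (simp add: lc zero_Q coset_eq_iff)
    from indep[OF this j(1)] show False using a(3) j(2) by simp
  qed
  have "V.dim = card (?q ` I)"
    using gen li sub fin by (intro V.dim_basis) (auto simp: V.basis_def)
  thus ?thesis using inj gen by (simp add: card_image image_image)
qed

end

section \<open>Cochains as structure matrices\<close>

locale heisenberg =
  fixes m n t :: nat and lam kap :: "nat \<Rightarrow> 'a::field"
  assumes m: "m \<ge> 1" and n: "n \<ge> 1" and t: "t \<ge> 1"
    and lam: "\<And>i. 1 \<le> i \<Longrightarrow> i \<le> m \<Longrightarrow> lam i \<noteq> 0"
    and kap: "\<And>j. 1 \<le> j \<Longrightarrow> j \<le> n \<Longrightarrow> kap j \<noteq> 0"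
    and two: "(2::'a) \<noteq> 0"
begin

abbreviation "G \<equiv> twisted_heisenberg m n t lam kap"
abbreviation "\<BB> \<equiv> hbase m n t"
abbreviation e :: "hidx \<Rightarrow> hidx \<Rightarrow> 'a" where "e \<equiv> sbv 1"
definition "z0 = Ev (2*m+1)"
definition "D0 = Ev (2*m+2)"
abbreviation (input) "entry \<phi> a b \<equiv> \<phi> (e a, e b)"

lemma special_simps [simp]:
  "hdeg z0 = 0" "hdeg D0 = 0" "z0 \<noteq> D0" "D0 \<noteq> z0"
  "Om j \<noteq> D0" "Et k \<noteq> D0" "Om j \<noteq> z0" "Et k \<noteq> z0"
  "D0 \<noteq> Om j" "D0 \<noteq> Et k" "z0 \<noteq> Om j" "z0 \<noteq> Et k"
  "Ev i = D0 \<longleftrightarrow> i = 2*m+2" "D0 = Ev i \<longleftrightarrow> i = 2*m+2"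
  "Ev i = z0 \<longleftrightarrow> i = 2*m+1" "z0 = Ev i \<longleftrightarrow> i = 2*m+1"
  by (auto simp: z0_def D0_def)

lemma finite_base: "finite \<BB>"
  by (simp add: hbase_def)

lemma base_simps [simp]:
  "Ev i \<in> \<BB> \<longleftrightarrow> 1 \<le> i \<and> i \<le> 2*m+2"
  "Om j \<in> \<BB> \<longleftrightarrow> 1 \<le> j \<and> j \<le> 2*n"
  "Et k \<in> \<BB> \<longleftrightarrow> 1 \<le> k \<and> k \<le> t"
  by (auto simp: hbase_def)

text \<open>Second halves are presented as \<open>m+i\<close> and \<open>n+j\<close>, so that the
  involution \<open>sg\<close> exchanges L with R and OL with OR, and facts about the bracket table
  reduce to a finite check.\<close>

lemma baseE:
  assumes "a \<in> \<BB>"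
  obtains (L) i where "a = Ev i" "1 \<le> i" "i \<le> m" | (R) i where "a = Ev (m+i)" "1 \<le> i" "i \<le> m"
  | (Z) "a = z0" | (D) "a = D0"
  | (OL) j where "a = Om j" "1 \<le> j" "j \<le> n" | (OR) j where "a = Om (n+j)" "1 \<le> j" "j \<le> n"
  | (E) k where "a = Et k" "1 \<le> k" "k \<le> t"
proof (cases a)
  case (Ev i)
  hence "i \<le> m \<or> (\<exists>k. i = m + k \<and> 1 \<le> k \<and> k \<le> m) \<or> i = 2*m+1 \<or> i = 2*m+2"
    using assms by (auto intro: exI[of _ "i-m"])
  thus ?thesis using L R Z D Ev assms by (auto simp: z0_def D0_def)
next
  case (Om j)
  hence "j \<le> n \<or> (\<exists>k. j = n + k \<and> 1 \<le> k \<and> k \<le> n)"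
    using assms by (auto intro: exI[of _ "j-n"])
  thus ?thesis using OL OR Om assms by auto
next
  case (Et k)
  thus ?thesis using E assms by auto
qed

lemma G_simps [simp]: "base G = \<BB>" "deg G = hdeg"
  by (simp_all add: twisted_heisenberg_def)

lemma hdeg_cases: "hdeg a = 0 \<or> hdeg a = 1"
  by (cases a) auto

lemma vecs_iff: "x \<in> vecs G \<longleftrightarrow> (\<forall>b. b \<notin> \<BB> \<longrightarrow> x b = 0)"
  by (simp add: vecs_def)

lemma e_apply: "e a b = (if b = a then 1 else 0)"
  by (simp add: sbv_def)

lemma e_vecs [simp]: "a \<in> \<BB> \<Longrightarrow> e a \<in> vecs G"
  by (auto simp: vecs_iff e_apply)

lemma e_hom [simp]: "a \<in> \<BB> \<Longrightarrow> e a \<in> hom_vecs G (hdeg a)"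
  by (auto simp: hom_vecs_def e_apply)

lemma sum_e: "a \<in> \<BB> \<Longrightarrow> (\<Sum>b\<in>\<BB>. e a b * f b) = f a"
  using finite_base by (simp add: e_apply if_distribR if_distrib [where f = "\<lambda>c. c * _"] cong: if_cong)

lemma linear_form_expand:
  assumes f: "linear_form_on (vecs G) f" and x: "x \<in> vecs G"
  shows "f x = (\<Sum>a\<in>\<BB>. x a * f (e a))"
proof -
  have lin: "f (\<lambda>b. c * u b + d * v b) = c * f u + d * f v" if "u \<in> vecs G" "v \<in> vecs G" for c d u v
    using f that by (auto simp: linear_form_on_def)
  \<comment> \<open>Membership of the partial sums is carried along, since linearity is available
    only inside \<open>vecs G\<close>.\<close>
  have "(\<lambda>k. \<Sum>a\<in>A. x a * e a k) \<in> vecs G \<and>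
      f (\<lambda>k. \<Sum>a\<in>A. x a * e a k) = (\<Sum>a\<in>A. x a * f (e a))" if "finite A" "A \<subseteq> \<BB>" for A
    using that
  proof (induction A rule: finite_induct)
    case empty
    have "(\<lambda>_. 0) \<in> vecs G" by (simp add: vecs_iff)
    from lin[OF this this, of 0 0] this show ?case by simp
  next
    case (insert a A)
    hence I: "(\<lambda>k. \<Sum>a\<in>A. x a * e a k) \<in> vecs G"
      "f (\<lambda>k. \<Sum>a\<in>A. x a * e a k) = (\<Sum>a\<in>A. x a * f (e a))" by auto
    have "e a \<in> vecs G" using insert by simp
    from lin[OF this I(1), of "x a" 1] this insert I show ?case
      by (simp add: vecs_iff)
  qed
  from this[OF finite_base order_refl]
  have "f (\<lambda>k. \<Sum>a\<in>\<BB>. x a * e a k) = (\<Sum>a\<in>\<BB>. x a * f (e a))" by blast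
  moreover have "(\<lambda>k. \<Sum>a\<in>\<BB>. x a * e a k) = x"
    using x finite_base by (auto simp: fun_eq_iff e_apply vecs_iff if_distrib cong: if_cong)
  ultimately show ?thesis by simp
qed

lemma cochains2D:
  assumes "\<phi> \<in> cochains2 G"
  shows cochains2_left: "y \<in> vecs G \<Longrightarrow> linear_form_on (vecs G) (\<lambda>x. \<phi> (x, y))"
    and cochains2_right: "x \<in> vecs G \<Longrightarrow> linear_form_on (vecs G) (\<lambda>y. \<phi> (x, y))"
    and cochains2_outside: "x \<notin> vecs G \<or> y \<notin> vecs G \<Longrightarrow> \<phi> (x, y) = 0"
    and entry_skew: "a \<in> \<BB> \<Longrightarrow> b \<in> \<BB> \<Longrightarrow> entry \<phi> a b = - ((-1) ^ (hdeg a * hdeg b) * entry \<phi> b a)"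
proof -
  show "a \<in> \<BB> \<Longrightarrow> b \<in> \<BB> \<Longrightarrow> entry \<phi> a b = - ((-1) ^ (hdeg a * hdeg b) * entry \<phi> b a)"
    using assms e_hom[of a] e_hom[of b] hdeg_cases[of a] hdeg_cases[of b]
    unfolding cochains2_def by blast
qed (use assms in \<open>auto simp: cochains2_def\<close>)

lemma cochains2_expand:
  assumes "\<phi> \<in> cochains2 G" "x \<in> vecs G" "y \<in> vecs G"
  shows "\<phi> (x, y) = (\<Sum>a\<in>\<BB>. \<Sum>b\<in>\<BB>. x a * y b * entry \<phi> a b)"
proof -
  have "\<phi> (x, y) = (\<Sum>a\<in>\<BB>. x a * \<phi> (e a, y))"
    by (rule linear_form_expand[OF cochains2_left]) (use assms in auto)
  also have "\<dots> = (\<Sum>a\<in>\<BB>. x a * (\<Sum>b\<in>\<BB>. y b * entry \<phi> a b))"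
    by (intro sum.cong refl arg_cong[of _ _ "\<lambda>u. _ * u"] linear_form_expand[OF cochains2_right])
      (use assms in auto)
  finally show ?thesis by (simp add: sum_distrib_left mult.assoc)
qed

lemma cochains2_eqI:
  assumes "\<phi> \<in> cochains2 G" "\<psi> \<in> cochains2 G" "\<And>a b. a \<in> \<BB> \<Longrightarrow> b \<in> \<BB> \<Longrightarrow> entry \<phi> a b = entry \<psi> a b"
  shows "\<phi> = \<psi>"
proof
  fix p :: "(hidx \<Rightarrow> 'a) \<times> (hidx \<Rightarrow> 'a)"
  obtain x y where p: "p = (x, y)" by (cases p)
  show "\<phi> p = \<psi> p"
  proof (cases "x \<in> vecs G \<and> y \<in> vecs G")
    case True
    hence xy: "x \<in> vecs G" "y \<in> vecs G" by auto
    show ?thesis unfolding p assms(1,2)[THEN cochains2_expand, OF xy]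
      using assms(3) by (intro sum.cong refl) simp
  next
    case False
    thus ?thesis unfolding p
      using assms(1,2)[THEN cochains2_outside] by auto
  qed
qed

definition bil :: "(hidx \<Rightarrow> hidx \<Rightarrow> 'a) \<Rightarrow> (hidx \<Rightarrow> 'a) \<times> (hidx \<Rightarrow> 'a) \<Rightarrow> 'a" where
  "bil M = (\<lambda>(x, y). if x \<in> vecs G \<and> y \<in> vecs G then \<Sum>a\<in>\<BB>. \<Sum>b\<in>\<BB>. x a * y b * M a b else 0)"

lemma sum_sum_lincomb:
  fixes F :: "'b \<Rightarrow> 'c \<Rightarrow> 'a"
  assumes "\<And>a b. F a b = c * F1 a b + d * F2 a b"
  shows "(\<Sum>a\<in>A. \<Sum>b\<in>B a. F a b) = c * (\<Sum>a\<in>A. \<Sum>b\<in>B a. F1 a b) + d * (\<Sum>a\<in>A. \<Sum>b\<in>B a. F2 a b)"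
  by (simp add: assms sum.distrib sum_distrib_left)

text \<open>A nonzero coefficient of a homogeneous vector fixes the parity of its index, so the sign
  attached to the arguments is the sign attached to the matrix entry.\<close>

lemma bil_cochains2:
  assumes "\<And>a b. a \<in> \<BB> \<Longrightarrow> b \<in> \<BB> \<Longrightarrow> M a b = - ((-1) ^ (hdeg a * hdeg b) * M b a)"
  shows "bil M \<in> cochains2 G"
proof -
  have comb: "(\<lambda>b. c * x b + d * y b) \<in> vecs G" if "x \<in> vecs G" "y \<in> vecs G" for c d x y
    using that by (simp add: vecs_iff)
  have "bil M (x, y) = - ((-1) ^ (p * q) * bil M (y, x))" if "x \<in> hom_vecs G p" "y \<in> hom_vecs G q" for p q x y
  proof -
    have "x a * y b * M a b = - ((-1) ^ (p * q) * (y b * x a * M b a))" if "a \<in> \<BB>" "b \<in> \<BB>" for a b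
    proof (cases "x a = 0 \<or> y b = 0")
      case False
      hence "hdeg a = p" "hdeg b = q"
        using \<open>x \<in> hom_vecs G p\<close> \<open>y \<in> hom_vecs G q\<close> by (auto simp: hom_vecs_def)
      thus ?thesis using assms[OF that] by (simp add: algebra_simps)
    qed auto
    hence "(\<Sum>a\<in>\<BB>. \<Sum>b\<in>\<BB>. x a * y b * M a b) =
        (\<Sum>a\<in>\<BB>. \<Sum>b\<in>\<BB>. - ((-1) ^ (p * q) * (y b * x a * M b a)))"
      by (intro sum.cong refl) blast
    also have "\<dots> = - ((-1) ^ (p * q) * (\<Sum>b\<in>\<BB>. \<Sum>a\<in>\<BB>. y b * x a * M b a))"
      by (subst sum.swap) (simp add: sum_distrib_left sum_negf)
    finally show ?thesis using that by (simp add: bil_def hom_vecs_def)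
  qed
  moreover have "bil M (\<lambda>b. c * x b + d * y b, u) = c * bil M (x, u) + d * bil M (y, u)"
    if "x \<in> vecs G" "y \<in> vecs G" "u \<in> vecs G" for c d x y u
  proof -
    have "(\<Sum>a\<in>\<BB>. \<Sum>b\<in>\<BB>. (c * x a + d * y a) * u b * M a b) =
        c * (\<Sum>a\<in>\<BB>. \<Sum>b\<in>\<BB>. x a * u b * M a b) + d * (\<Sum>a\<in>\<BB>. \<Sum>b\<in>\<BB>. y a * u b * M a b)"
      by (rule sum_sum_lincomb) (simp add: algebra_simps)
    thus ?thesis using that comb by (simp add: bil_def)
  qed
  moreover have "bil M (u, \<lambda>b. c * x b + d * y b) = c * bil M (u, x) + d * bil M (u, y)"
    if "x \<in> vecs G" "y \<in> vecs G" "u \<in> vecs G" for c d x y u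
  proof -
    have "(\<Sum>a\<in>\<BB>. \<Sum>b\<in>\<BB>. u a * (c * x b + d * y b) * M a b) =
        c * (\<Sum>a\<in>\<BB>. \<Sum>b\<in>\<BB>. u a * x b * M a b) + d * (\<Sum>a\<in>\<BB>. \<Sum>b\<in>\<BB>. u a * y b * M a b)"
      by (rule sum_sum_lincomb) (simp add: algebra_simps)
    thus ?thesis using that comb by (simp add: bil_def)
  qed
  moreover have "bil M (x, y) = 0" if "x \<notin> vecs G \<or> y \<notin> vecs G" for x y
    using that by (auto simp: bil_def)
  ultimately show ?thesis
    unfolding cochains2_def linear_form_on_def by blast
qed

text \<open>A combination of cochains is \<open>bil\<close> of the combined matrix, and there
  skewness is a linear condition on entries.\<close>

lemma lin_closed_cochains2: "lin_closed (cochains2 G)"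
proof -
  have "(\<lambda>p. c * \<phi> p + \<psi> p) \<in> cochains2 G" if "\<phi> \<in> cochains2 G" "\<psi> \<in> cochains2 G" for c \<phi> \<psi>
  proof -
    let ?M = "\<lambda>a b. c * entry \<phi> a b + entry \<psi> a b"
    have "(\<lambda>p. c * \<phi> p + \<psi> p) = bil ?M"
    proof
      fix p :: "(hidx \<Rightarrow> 'a) \<times> (hidx \<Rightarrow> 'a)"
      obtain x y where p: "p = (x, y)" by (cases p)
      show "c * \<phi> p + \<psi> p = bil ?M p"
      proof (cases "x \<in> vecs G \<and> y \<in> vecs G")
        case True
        hence xy: "x \<in> vecs G" "y \<in> vecs G" by auto
        show ?thesis unfolding p that[THEN cochains2_expand, OF xy]
          using sum_sum_lincomb[of "\<lambda>a b. x a * y b * ?M a b" c "\<lambda>a b. x a * y b * entry \<phi> a b"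
              1 "\<lambda>a b. x a * y b * entry \<psi> a b" "\<lambda>_. \<BB>" \<BB>]
          by (simp add: xy bil_def algebra_simps)
      next
        case False
        thus ?thesis unfolding p using that[THEN cochains2_outside] by (auto simp: bil_def)
      qed
    qed
    moreover have "bil ?M \<in> cochains2 G"
    proof (rule bil_cochains2)
      fix a b assume "a \<in> \<BB>" "b \<in> \<BB>"
      from that(1)[THEN entry_skew, OF this] that(2)[THEN entry_skew, OF this]
      show "?M a b = - ((-1) ^ (hdeg a * hdeg b) * ?M b a)" by (simp add: algebra_simps)
    qed
    ultimately show ?thesis by simp
  qed
  moreover have "(\<lambda>_. 0) \<in> cochains2 G" by (simp add: cochains2_def linear_form_on_def)
  ultimately show ?thesis by (simp add: lin_closed_def)
qed

lemma lin_closed_parity2: "lin_closed (parity2 G s)"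
  by (auto simp: lin_closed_def parity2_def)

lemma parity2_iff:
  assumes "\<phi> \<in> cochains2 G"
  shows "\<phi> \<in> parity2 G s \<longleftrightarrow> (\<forall>a\<in>\<BB>. \<forall>b\<in>\<BB>. (hdeg a + hdeg b) mod 2 \<noteq> s \<longrightarrow> entry \<phi> a b = 0)"
proof
  assume "\<phi> \<in> parity2 G s"
  thus "\<forall>a\<in>\<BB>. \<forall>b\<in>\<BB>. (hdeg a + hdeg b) mod 2 \<noteq> s \<longrightarrow> entry \<phi> a b = 0"
    using e_hom hdeg_cases unfolding parity2_def by blast
next
  assume R: "\<forall>a\<in>\<BB>. \<forall>b\<in>\<BB>. (hdeg a + hdeg b) mod 2 \<noteq> s \<longrightarrow> entry \<phi> a b = 0"
  have "\<phi> (x, y) = 0" if "(p + q) mod 2 \<noteq> s" "x \<in> hom_vecs G p" "y \<in> hom_vecs G q" for p q x y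
  proof -
    have "x a * y b * entry \<phi> a b = 0" if "a \<in> \<BB>" "b \<in> \<BB>" for a b
    proof (cases "x a = 0 \<or> y b = 0")
      case False
      hence "hdeg a = p" "hdeg b = q"
        using \<open>x \<in> hom_vecs G p\<close> \<open>y \<in> hom_vecs G q\<close> by (auto simp: hom_vecs_def)
      thus ?thesis using R that \<open>(p + q) mod 2 \<noteq> s\<close> by simp
    qed auto
    moreover have "x \<in> vecs G" "y \<in> vecs G" using that by (auto simp: hom_vecs_def)
    ultimately show ?thesis
      unfolding cochains2_expand[OF assms \<open>x \<in> vecs G\<close> \<open>y \<in> vecs G\<close>]
      by (intro sum.neutral ballI) blast
  qed
  thus "\<phi> \<in> parity2 G s" unfolding parity2_def by blast
qed

section \<open>The bracket as a central form plus the action of D\<close>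

lemma bracket_apply:
  "bracket G x y = (\<lambda>c. \<Sum>a\<in>\<BB>. \<Sum>b\<in>\<BB>. x a * y b * hstruct m n lam kap a b c)"
  by (simp add: twisted_heisenberg_def)

lemma bracket_e:
  assumes "a \<in> \<BB>" "b \<in> \<BB>"
  shows "bracket G (e a) (e b) = hstruct m n lam kap a b"
  using assms by (simp add: bracket_apply mult.assoc sum_distrib_left[symmetric] sum_e)

text \<open>On basis vectors, \<open>[D0, b] = wt b * sg b\<close>, and \<open>bt a b\<close> is the centre coefficient of \<open>[a, b]\<close>.\<close>

fun sg :: "hidx \<Rightarrow> hidx" where
  "sg (Ev i) = (if i \<le> m then Ev (m+i) else if i \<le> 2*m then Ev (i-m) else Ev i)"
| "sg (Om j) = (if j \<le> n then Om (n+j) else Om (j-n))"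
| "sg (Et k) = Et k"

fun wt :: "hidx \<Rightarrow> 'a" where
  "wt (Ev i) = (if i \<le> m then lam i else if i \<le> 2*m then lam (i-m) else 0)"
| "wt (Om j) = (if j \<le> n then kap j else kap (j-n))"
| "wt (Et k) = 0"

fun bt :: "hidx \<Rightarrow> hidx \<Rightarrow> 'a" where
  "bt (Ev i) (Ev j) = (if i \<le> m \<and> j = m + i then 1 else if j \<le> m \<and> i = m + j then -1 else 0)"
| "bt (Om i) (Om j) = (if i = j then if i \<le> n then 1 else -1 else 0)"
| "bt (Et k) (Et l) = (if k = l then 1 else 0)"
| "bt _ _ = 0"

text \<open>Every bracket of basis vectors is a multiple of z plus the action of D from the left or
  from the right; as D is even, the two actions differ by a plain sign.\<close>

lemma hstruct_eq:
  assumes "a \<in> \<BB>" "b \<in> \<BB>"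
  shows "hstruct m n lam kap a b c =
    bt a b * e z0 c + (if a = D0 then wt b * e (sg b) c else 0) - (if b = D0 then wt a * e (sg a) c else 0)"
  by (rule baseE[OF assms(1)]; rule baseE[OF assms(2)];
      simp add: hstruct_def sbv_def z0_def D0_def)

lemma sg_base [simp]: "a \<in> \<BB> \<Longrightarrow> sg a \<in> \<BB>"
  by (cases a) auto

lemma sg_sg [simp]: "a \<in> \<BB> \<Longrightarrow> sg (sg a) = a"
  by (cases a) auto

lemma sg_eq_iff [simp]: "a \<in> \<BB> \<Longrightarrow> b \<in> \<BB> \<Longrightarrow> sg a = sg b \<longleftrightarrow> a = b"
  by (metis sg_sg)

lemma wt_sg [simp]: "a \<in> \<BB> \<Longrightarrow> wt (sg a) = wt a"
  by (cases a) auto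

lemma hdeg_sg [simp]: "hdeg (sg a) = hdeg a"
  by (cases a) auto

lemma sg_eq_D0 [simp]: "a \<in> \<BB> \<Longrightarrow> sg a = D0 \<longleftrightarrow> a = D0"
  by (cases a) auto

lemma D0_z0_base [simp]: "D0 \<in> \<BB>" "z0 \<in> \<BB>"
  by (auto simp: D0_def z0_def)

lemma wt_D0 [simp]: "wt D0 = 0" and wt_z0 [simp]: "wt z0 = 0"
  and sg_D0 [simp]: "sg D0 = D0" and sg_z0 [simp]: "sg z0 = z0"
  by (auto simp: D0_def z0_def)

lemma bt_D0 [simp]: "bt D0 b = 0" "b \<in> \<BB> \<Longrightarrow> bt b D0 = 0"
  by (cases b; auto simp: D0_def)+

lemma bt_z0 [simp]: "b \<in> \<BB> \<Longrightarrow> bt z0 b = 0"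
  by (cases b) (auto simp: z0_def)

lemma bt_skew: "bt a b = - ((-1) ^ (hdeg a * hdeg b) * bt b a)" if "a \<in> \<BB>" "b \<in> \<BB>"
  by (rule baseE[OF that(1)]; rule baseE[OF that(2)]; simp add: z0_def D0_def)

text \<open>This is the Jacobi identity for D, a, b, since D kills z. On the odd part it rests on
  the opposite signs of the squares of \<open>Om j\<close> and \<open>Om (n+j)\<close>.\<close>

lemma bt_invariant: "wt a * bt (sg a) b + wt b * bt a (sg b) = 0" if "a \<in> \<BB>" "b \<in> \<BB>"
  by (rule baseE[OF that(1)]; rule baseE[OF that(2)]; simp add: z0_def D0_def)

lemma bracket_vecs [simp]: "bracket G x y \<in> vecs G"
proof -
  have "hstruct m n lam kap a b c = 0" if "a \<in> \<BB>" "b \<in> \<BB>" "c \<notin> \<BB>" for a b c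
  proof -
    have "c \<noteq> sg a" "c \<noteq> sg b" "c \<noteq> z0" using that by force+
    thus ?thesis using that by (simp add: hstruct_eq e_apply)
  qed
  thus ?thesis by (simp add: vecs_iff bracket_apply)
qed

lemma linear_form_bracket_e:
  assumes f: "linear_form_on (vecs G) f" and "a \<in> \<BB>" "b \<in> \<BB>"
  shows "f (bracket G (e a) (e b)) =
    bt a b * f (e z0) + (if a = D0 then wt b * f (e (sg b)) else 0) - (if b = D0 then wt a * f (e (sg a)) else 0)"
proof -
  have "f (bracket G (e a) (e b)) = (\<Sum>c\<in>\<BB>. hstruct m n lam kap a b c * f (e c))"
    using linear_form_expand[OF f bracket_vecs, of "e a" "e b"] assms by (simp add: bracket_e)
  also have "\<dots> = (\<Sum>c\<in>\<BB>. bt a b * (e z0 c * f (e c)) + (if a = D0 then wt b else 0) * (e (sg b) c * f (e c))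
      - (if b = D0 then wt a else 0) * (e (sg a) c * f (e c)))"
    using assms by (intro sum.cong) (auto simp: hstruct_eq algebra_simps)
  also have "\<dots> = bt a b * f (e z0) + (if a = D0 then wt b else 0) * f (e (sg b)) - (if b = D0 then wt a else 0) * f (e (sg a))"
    unfolding sum_subtractf sum.distrib sum_distrib_left[symmetric] using assms by (simp add: sum_e)
  finally show ?thesis by simp
qed

lemma linear_form_bracket:
  assumes f: "linear_form_on (vecs G) f"
  shows "linear_form_on (vecs G) (\<lambda>x. f (bracket G x y))" and "linear_form_on (vecs G) (\<lambda>x. f (bracket G y x))"
proof -
  have "bracket G (\<lambda>b. c * x b + d * x' b) y = (\<lambda>b. c * bracket G x y b + d * bracket G x' y b)" for c d x x'
    by (simp add: bracket_apply algebra_simps sum.distrib sum_distrib_left)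
  thus "linear_form_on (vecs G) (\<lambda>x. f (bracket G x y))"
    using f by (simp add: linear_form_on_def)
  have "bracket G y (\<lambda>b. c * x b + d * x' b) = (\<lambda>b. c * bracket G y x b + d * bracket G y x' b)" for c d x x'
    by (simp add: bracket_apply algebra_simps sum.distrib sum_distrib_left)
  thus "linear_form_on (vecs G) (\<lambda>x. f (bracket G y x))"
    using f by (simp add: linear_form_on_def)
qed

section \<open>The cocycle condition on triples of basis vectors\<close>

definition d2_mat :: "((hidx \<Rightarrow> 'a) \<times> (hidx \<Rightarrow> 'a) \<Rightarrow> 'a) \<Rightarrow> hidx \<Rightarrow> hidx \<Rightarrow> hidx \<Rightarrow> 'a" where
  "d2_mat \<phi> a b c = d2_hom G \<phi> (hdeg a) (hdeg b) (hdeg c) (e a) (e b) (e c)"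

text \<open>Basis vectors are homogeneous, so a triple of them meets exactly one summand of the sum
  over parities, the one whose signs come from its own degrees.\<close>

lemma d2_expand:
  assumes \<phi>: "\<phi> \<in> cochains2 G" and v: "g \<in> vecs G" "h \<in> vecs G" "f \<in> vecs G"
  shows "d2 G \<phi> (g, h, f) = (\<Sum>a\<in>\<BB>. \<Sum>b\<in>\<BB>. \<Sum>c\<in>\<BB>. g a * h b * f c * d2_mat \<phi> a b c)"
proof -
  define T where "T x y u = \<phi> (bracket G x y, u)" for x y u
  have T: "T x y u = (\<Sum>a\<in>\<BB>. \<Sum>b\<in>\<BB>. \<Sum>c\<in>\<BB>. x a * y b * u c * T (e a) (e b) (e c))"
    if "x \<in> vecs G" "y \<in> vecs G" "u \<in> vecs G" for x y u
  proof -
    have "T x y u = (\<Sum>a\<in>\<BB>. x a * T (e a) y u)"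
      unfolding T_def using that
      by (intro linear_form_expand linear_form_bracket(1)[of "\<lambda>w. \<phi> (w, u)"] cochains2_left[OF \<phi>])
    also have "\<dots> = (\<Sum>a\<in>\<BB>. x a * (\<Sum>b\<in>\<BB>. y b * T (e a) (e b) u))"
      unfolding T_def using that
      by (intro sum.cong refl arg_cong[of _ _ "\<lambda>u. _ * u"] linear_form_expand
          linear_form_bracket(2)[of "\<lambda>w. \<phi> (w, u)"] cochains2_left[OF \<phi>])
    also have "\<dots> = (\<Sum>a\<in>\<BB>. x a * (\<Sum>b\<in>\<BB>. y b * (\<Sum>c\<in>\<BB>. u c * T (e a) (e b) (e c))))"
      unfolding T_def using that
      by (intro sum.cong refl arg_cong[of _ _ "\<lambda>u. _ * u"] linear_form_expand cochains2_right[OF \<phi>]) auto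
    finally show ?thesis by (simp add: sum_distrib_left mult.assoc)
  qed
  have hc: "hcomp G p x \<in> vecs G" if "x \<in> vecs G" for p x
    using that by (simp add: vecs_iff hcomp_def)
  have hom: "d2_hom G \<phi> pg ph pf x y u =
      (\<Sum>a\<in>\<BB>. \<Sum>b\<in>\<BB>. \<Sum>c\<in>\<BB>. x a * y b * u c * d2_hom G \<phi> pg ph pf (e a) (e b) (e c))"
    if "x \<in> vecs G" "y \<in> vecs G" "u \<in> vecs G" for pg ph pf x y u
  proof -
    \<comment> \<open>All three terms are rewritten over the same triple \<open>(a, b, c)\<close>,
      so that they share the coefficient \<open>x a * y b * u c\<close>.\<close>
    have 1: "T x u y = (\<Sum>a\<in>\<BB>. \<Sum>b\<in>\<BB>. \<Sum>c\<in>\<BB>. x a * y b * u c * T (e a) (e c) (e b))"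
    proof -
      have "T x u y = (\<Sum>a\<in>\<BB>. \<Sum>c\<in>\<BB>. \<Sum>b\<in>\<BB>. x a * u b * y c * T (e a) (e b) (e c))"
        unfolding T[OF that(1,3,2)] by (intro sum.cong refl sum.swap)
      thus ?thesis by (simp add: ac_simps)
    qed
    have "T y u x = (\<Sum>b\<in>\<BB>. \<Sum>c\<in>\<BB>. \<Sum>a\<in>\<BB>. x a * y b * u c * T (e b) (e c) (e a))"
      unfolding T[OF that(2,3,1)] by (simp add: ac_simps)
    also have "\<dots> = (\<Sum>b\<in>\<BB>. \<Sum>a\<in>\<BB>. \<Sum>c\<in>\<BB>. x a * y b * u c * T (e b) (e c) (e a))"
      by (intro sum.cong refl sum.swap)
    also have "\<dots> = (\<Sum>a\<in>\<BB>. \<Sum>b\<in>\<BB>. \<Sum>c\<in>\<BB>. x a * y b * u c * T (e b) (e c) (e a))"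
      by (rule sum.swap)
    finally have 2: "T y u x = (\<Sum>a\<in>\<BB>. \<Sum>b\<in>\<BB>. \<Sum>c\<in>\<BB>. x a * y b * u c * T (e b) (e c) (e a))" .
    show ?thesis
      unfolding d2_hom_def T_def[symmetric] unfolding 1 2 T[OF that(1,2,3)]
      by (simp add: sum_subtractf sum.distrib sum_distrib_left algebra_simps)
  qed
  have "d2_hom G \<phi> pg ph pf (hcomp G pg g) (hcomp G ph h) (hcomp G pf f) =
      (\<Sum>a\<in>\<BB>. \<Sum>b\<in>\<BB>. \<Sum>c\<in>\<BB>. hcomp G pg g a * hcomp G ph h b * hcomp G pf f c * d2_mat \<phi> a b c)" for pg ph pf
    unfolding hom[OF hc[OF v(1)] hc[OF v(2)] hc[OF v(3)]]
    by (intro sum.cong) (auto simp: hcomp_def d2_mat_def)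
  hence "d2 G \<phi> (g, h, f) = (\<Sum>a\<in>\<BB>. \<Sum>b\<in>\<BB>. \<Sum>c\<in>\<BB>. \<Sum>pg\<in>{0,1}. \<Sum>ph\<in>{0,1}. \<Sum>pf\<in>{0,1}.
      hcomp G pg g a * hcomp G ph h b * hcomp G pf f c * d2_mat \<phi> a b c)"
    using v by (simp add: d2_def sum.distrib)
  also have "\<dots> = (\<Sum>a\<in>\<BB>. \<Sum>b\<in>\<BB>. \<Sum>c\<in>\<BB>. g a * h b * f c * d2_mat \<phi> a b c)"
  proof (intro sum.cong refl)
    fix a b c
    show "(\<Sum>pg\<in>{0,1}. \<Sum>ph\<in>{0,1}. \<Sum>pf\<in>{0,1}.
        hcomp G pg g a * hcomp G ph h b * hcomp G pf f c * d2_mat \<phi> a b c) = g a * h b * f c * d2_mat \<phi> a b c"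
      using hdeg_cases[of a] hdeg_cases[of b] hdeg_cases[of c] by (auto simp: hcomp_def)
  qed
  finally show ?thesis .
qed

lemma cocycles2_iff_d2_mat:
  "\<phi> \<in> cocycles2 G \<longleftrightarrow> \<phi> \<in> cochains2 G \<and> (\<forall>a\<in>\<BB>. \<forall>b\<in>\<BB>. \<forall>c\<in>\<BB>. d2_mat \<phi> a b c = 0)"
proof -
  have "(\<forall>a\<in>\<BB>. \<forall>b\<in>\<BB>. \<forall>c\<in>\<BB>. d2_mat \<phi> a b c = 0) \<longleftrightarrow> d2 G \<phi> = (\<lambda>_. 0)" if \<phi>: "\<phi> \<in> cochains2 G"
  proof
    assume "d2 G \<phi> = (\<lambda>_. 0)"
    moreover have "d2 G \<phi> (e a, e b, e c) = d2_mat \<phi> a b c" if "a \<in> \<BB>" "b \<in> \<BB>" "c \<in> \<BB>" for a b c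
      using that by (simp add: d2_expand[OF \<phi>] mult.assoc sum_distrib_left[symmetric] sum_e)
    ultimately show "\<forall>a\<in>\<BB>. \<forall>b\<in>\<BB>. \<forall>c\<in>\<BB>. d2_mat \<phi> a b c = 0"
      by (metis (mono_tags))
  next
    assume *: "\<forall>a\<in>\<BB>. \<forall>b\<in>\<BB>. \<forall>c\<in>\<BB>. d2_mat \<phi> a b c = 0"
    have "d2 G \<phi> (g, h, f) = 0" for g h f
    proof (cases "g \<in> vecs G \<and> h \<in> vecs G \<and> f \<in> vecs G")
      case True
      thus ?thesis using * by (simp add: d2_expand[OF \<phi>])
    next
      case False
      thus ?thesis by (auto simp: d2_def)
    qed
    thus "d2 G \<phi> = (\<lambda>_. 0)" by auto
  qed
  thus ?thesis by (auto simp: cocycles2_def)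
qed

lemma entry_bracket:
  assumes "\<phi> \<in> cochains2 G" "a \<in> \<BB>" "b \<in> \<BB>" "c \<in> \<BB>"
  shows "\<phi> (bracket G (e a) (e b), e c) =
    bt a b * entry \<phi> z0 c + (if a = D0 then wt b * entry \<phi> (sg b) c else 0) - (if b = D0 then wt a * entry \<phi> (sg a) c else 0)"
  using linear_form_bracket_e[OF cochains2_left[OF assms(1) e_vecs[OF assms(4)]] assms(2,3)] .

lemma d2_mat_eq:
  assumes "\<phi> \<in> cochains2 G" "a \<in> \<BB>" "b \<in> \<BB>" "c \<in> \<BB>"
  shows "d2_mat \<phi> a b c =
    (bt a b * entry \<phi> z0 c + (if a = D0 then wt b * entry \<phi> (sg b) c else 0) - (if b = D0 then wt a * entry \<phi> (sg a) c else 0))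
    - (-1) ^ (hdeg c * hdeg b) * (bt a c * entry \<phi> z0 b + (if a = D0 then wt c * entry \<phi> (sg c) b else 0) - (if c = D0 then wt a * entry \<phi> (sg a) b else 0))
    + (-1) ^ (hdeg a * (hdeg b + hdeg c)) * (bt b c * entry \<phi> z0 a + (if b = D0 then wt c * entry \<phi> (sg c) a else 0) - (if c = D0 then wt b * entry \<phi> (sg b) a else 0))"
  using assms by (simp add: d2_mat_def d2_hom_def entry_bracket)

lemma entry_even_skew:
  "\<phi> \<in> cochains2 G \<Longrightarrow> a \<in> \<BB> \<Longrightarrow> b \<in> \<BB> \<Longrightarrow> hdeg a = 0 \<or> hdeg b = 0 \<Longrightarrow> entry \<phi> a b = - entry \<phi> b a"
  by (drule entry_skew[of \<phi> a b]) auto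

lemma entry_odd_sym:
  "\<phi> \<in> cochains2 G \<Longrightarrow> a \<in> \<BB> \<Longrightarrow> b \<in> \<BB> \<Longrightarrow> hdeg a = 1 \<Longrightarrow> hdeg b = 1 \<Longrightarrow> entry \<phi> a b = entry \<phi> b a"
  by (drule entry_skew[of \<phi> a b]) auto

lemma entry_even_diag:
  assumes "\<phi> \<in> cochains2 G" "a \<in> \<BB>" "hdeg a = 0"
  shows "entry \<phi> a a = 0"
proof -
  have "2 * entry \<phi> a a = 0" using entry_even_skew[OF assms(1,2,2)] assms(3)
    by (metis add.right_inverse mult_2)
  thus ?thesis using two by simp
qed

lemma cocycles2_cochains2: "\<phi> \<in> cocycles2 G \<Longrightarrow> \<phi> \<in> cochains2 G"
  by (simp add: cocycles2_def)

lemma cocycle_central: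
  assumes "\<phi> \<in> cocycles2 G" "b \<in> \<BB>"
  shows "entry \<phi> z0 b = 0"
proof -
  have \<phi>: "\<phi> \<in> cochains2 G" and d: "\<And>a b c. a \<in> \<BB> \<Longrightarrow> b \<in> \<BB> \<Longrightarrow> c \<in> \<BB> \<Longrightarrow> d2_mat \<phi> a b c = 0"
    using assms(1) by (auto simp: cocycles2_iff_d2_mat)
  show ?thesis
  \<comment> \<open>The test pair has bracket z and is of another kind than \<open>b\<close>, so
    only the value at \<open>(z0, b)\<close> remains. For even \<open>b\<close> it is
    \<open>(Et 1, Et 1)\<close>, whose weight 0 also removes the action terms when
    \<open>b = D0\<close>.\<close>
  proof (cases b)
    case (Ev i)
    thus ?thesis using d[of "Et 1" "Et 1" b] d2_mat_eq[OF \<phi>, of "Et 1" "Et 1" b] t assms(2) by (auto split: if_splits)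
  next
    case (Om j)
    thus ?thesis using d[of "Et 1" "Et 1" b] d2_mat_eq[OF \<phi>, of "Et 1" "Et 1" b] t assms(2) by (auto split: if_splits)
  next
    case (Et k)
    thus ?thesis using d[of "Ev 1" "Ev (m+1)" b] d2_mat_eq[OF \<phi>, of "Ev 1" "Ev (m+1)" b] m assms(2) by (auto split: if_splits)
  qed
qed

text \<open>The cocycle condition at \<open>(D0, a, b)\<close>, whose last term is a multiple of the
  value at \<open>(z0, D0)\<close> and vanishes. At \<open>a = D0\<close> the identity would read
  \<open>wt b * entry \<phi> D0 (sg b) = 0\<close>, which coboundaries violate.\<close>

lemma cocycle_invariant:
  assumes "\<phi> \<in> cocycles2 G" "a \<in> \<BB>" "b \<in> \<BB>" "a \<noteq> D0" "b \<noteq> D0"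
  shows "wt a * entry \<phi> (sg a) b + wt b * entry \<phi> a (sg b) = 0"
proof -
  have \<phi>: "\<phi> \<in> cochains2 G" and "d2_mat \<phi> D0 a b = 0"
    using assms by (auto simp: cocycles2_iff_d2_mat)
  thus ?thesis using d2_mat_eq[OF \<phi>, of D0 a b] assms cocycle_central[OF assms(1), of D0]
      entry_skew[OF \<phi>, of "sg b" a] hdeg_cases[of a] hdeg_cases[of b] by auto
qed

text \<open>Triples without \<open>D0\<close> involve only values at \<open>z0\<close>, triples with
  one \<open>D0\<close> reduce to invariance, and with two or three the action terms cancel.\<close>

lemma cocycleI:
  assumes \<phi>: "\<phi> \<in> cochains2 G" and z: "\<And>b. b \<in> \<BB> \<Longrightarrow> entry \<phi> z0 b = 0"
    and inv: "\<And>a b. a \<in> \<BB> \<Longrightarrow> b \<in> \<BB> \<Longrightarrow> a \<noteq> D0 \<Longrightarrow> b \<noteq> D0 \<Longrightarrow> wt a * entry \<phi> (sg a) b + wt b * entry \<phi> a (sg b) = 0"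
  shows "\<phi> \<in> cocycles2 G"
proof -
  have "d2_mat \<phi> a b c = 0" if abc: "a \<in> \<BB>" "b \<in> \<BB>" "c \<in> \<BB>" for a b c
    using inv[of a b] inv[of b c] inv[of a c] entry_skew[OF \<phi>, of "sg b" a] entry_skew[OF \<phi>, of "sg c" b] entry_skew[OF \<phi>, of "sg c" a]
      hdeg_cases[of a] hdeg_cases[of b] hdeg_cases[of c] abc
    by (cases "a = D0"; cases "b = D0"; cases "c = D0") (auto simp: d2_mat_eq[OF \<phi>] z algebra_simps neg_eq_iff_add_eq_0)
  thus ?thesis using \<phi> by (simp add: cocycles2_iff_d2_mat)
qed

lemma lin_closed_cocycles2: "lin_closed (cocycles2 G)"
proof -
  have "(\<lambda>p. c * \<phi> p + \<psi> p) \<in> cocycles2 G" if "\<phi> \<in> cocycles2 G" "\<psi> \<in> cocycles2 G" for c \<phi> \<psi>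
  proof (rule cocycleI)
    fix a b assume "a \<in> \<BB>" "b \<in> \<BB>" "a \<noteq> D0" "b \<noteq> D0"
    from that[THEN cocycle_invariant, OF this]
    have "c * (wt a * entry \<phi> (sg a) b + wt b * entry \<phi> a (sg b)) + (wt a * entry \<psi> (sg a) b + wt b * entry \<psi> a (sg b)) = 0"
      by simp
    thus "wt a * (c * entry \<phi> (sg a) b + entry \<psi> (sg a) b) + wt b * (c * entry \<phi> a (sg b) + entry \<psi> a (sg b)) = 0"
      by (simp add: algebra_simps)
  qed (use that lin_closed_cochains2 in \<open>auto simp: cocycle_central lin_closed_def cocycles2_cochains2\<close>)
  moreover have "(\<lambda>_. 0) \<in> cocycles2 G"
    by (rule cocycleI) (use lin_closed_zero[OF lin_closed_cochains2] in auto)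
  ultimately show ?thesis by (simp add: lin_closed_def)
qed

section \<open>Pivots\<close>

lemma cochains1_expand:
  assumes "\<psi> \<in> cochains1 G" "x \<in> vecs G"
  shows "\<psi> x = (\<Sum>a\<in>\<BB>. x a * \<psi> (e a))"
  using assms by (intro linear_form_expand) (auto simp: cochains1_def)

lemma lin_closed_cochains1: "lin_closed (cochains1 G)"
  by (auto simp: lin_closed_def cochains1_def linear_form_on_def algebra_simps)

lemma cochains1_of_coeffs:
  "(\<lambda>x. if x \<in> vecs G then \<Sum>a\<in>\<BB>. x a * c a else 0) \<in> cochains1 G"
proof -
  have "(\<lambda>b. r * x b + s * y b) \<in> vecs G" if "x \<in> vecs G" "y \<in> vecs G" for r s x y
    using that by (simp add: vecs_iff)
  thus ?thesis
    by (simp add: cochains1_def linear_form_on_def sum.distrib sum_distrib_left distrib_right mult.assoc)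
qed

lemma d1_entry:
  assumes "\<psi> \<in> cochains1 G" "a \<in> \<BB>" "b \<in> \<BB>"
  shows "entry (d1 G \<psi>) a b =
    bt a b * \<psi> (e z0) + (if a = D0 then wt b * \<psi> (e (sg b)) else 0) - (if b = D0 then wt a * \<psi> (e (sg a)) else 0)"
proof -
  have "linear_form_on (vecs G) \<psi>" using assms(1) by (simp add: cochains1_def)
  from linear_form_bracket_e[OF this assms(2,3)] assms(2,3) show ?thesis by (simp add: d1_def)
qed

lemma d1_cochains2:
  assumes "\<psi> \<in> cochains1 G"
  shows "d1 G \<psi> \<in> cochains2 G"
proof -
  have lin: "linear_form_on (vecs G) \<psi>" using assms by (simp add: cochains1_def)
  have eq: "d1 G \<psi> (x, y) = bil (entry (d1 G \<psi>)) (x, y)" for x y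
  proof (cases "x \<in> vecs G \<and> y \<in> vecs G")
    case True
    hence "\<psi> (bracket G x y) = (\<Sum>a\<in>\<BB>. x a * \<psi> (bracket G (e a) y))"
      by (intro linear_form_expand linear_form_bracket lin) auto
    also have "\<dots> = (\<Sum>a\<in>\<BB>. x a * (\<Sum>b\<in>\<BB>. y b * \<psi> (bracket G (e a) (e b))))"
      using True
      by (intro sum.cong refl arg_cong[of _ _ "\<lambda>u. _ * u"] linear_form_expand linear_form_bracket lin) auto
    finally show ?thesis using True by (simp add: d1_def bil_def sum_distrib_left mult.assoc)
  next
    case False
    thus ?thesis by (auto simp: d1_def bil_def)
  qed
  have "d1 G \<psi> = bil (entry (d1 G \<psi>))"
    by (rule ext, rule prod.induct, rule eq)
  moreover have "bil (entry (d1 G \<psi>)) \<in> cochains2 G"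
  proof (rule bil_cochains2)
    fix a b assume ab: "a \<in> \<BB>" "b \<in> \<BB>"
    show "entry (d1 G \<psi>) a b = - ((-1) ^ (hdeg a * hdeg b) * entry (d1 G \<psi>) b a)"
      unfolding d1_entry[OF assms ab] d1_entry[OF assms ab(2,1)]
      using bt_skew[OF ab] ab by (auto simp: algebra_simps)
  qed
  ultimately show ?thesis by simp
qed

text \<open>Away from \<open>D0\<close> a coboundary is a multiple of \<open>bt\<close>, so
  invariance is \<open>bt_invariant\<close>; the values at \<open>D0\<close> do not enter the
  criterion.\<close>

lemma d1_cocycles2:
  assumes "\<psi> \<in> cochains1 G"
  shows "d1 G \<psi> \<in> cocycles2 G"
proof (rule cocycleI[OF d1_cochains2[OF assms]])
  show "entry (d1 G \<psi>) z0 b = 0" if "b \<in> \<BB>" for b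
    using that by (simp add: d1_entry[OF assms])
  show "wt a * entry (d1 G \<psi>) (sg a) b + wt b * entry (d1 G \<psi>) a (sg b) = 0"
    if "a \<in> \<BB>" "b \<in> \<BB>" "a \<noteq> D0" "b \<noteq> D0" for a b
  proof -
    have "wt a * (bt (sg a) b * \<psi> (e z0)) + wt b * (bt a (sg b) * \<psi> (e z0)) =
        (wt a * bt (sg a) b + wt b * bt a (sg b)) * \<psi> (e z0)"
      by (simp add: algebra_simps)
    thus ?thesis using that bt_invariant[OF that(1,2)] by (simp add: d1_entry[OF assms])
  qed
qed

lemma lin_closed_coboundaries2: "lin_closed (coboundaries2 G)"
proof -
  have "(\<lambda>p. c * f p + g p) \<in> coboundaries2 G" if fg: "f \<in> coboundaries2 G" "g \<in> coboundaries2 G" for c f g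
  proof -
    obtain \<psi> \<chi> where \<psi>: "\<psi> \<in> cochains1 G" "\<chi> \<in> cochains1 G" "f = d1 G \<psi>" "g = d1 G \<chi>"
      using fg by (auto simp: coboundaries2_def)
    hence "(\<lambda>p. c * f p + g p) = d1 G (\<lambda>x. c * \<psi> x + \<chi> x)" by (auto simp: d1_def)
    thus ?thesis using lin_closed_axpy[OF lin_closed_cochains1 \<psi>(1,2)] by (simp add: coboundaries2_def)
  qed
  moreover have "(\<lambda>_. 0) = d1 G (\<lambda>_. 0)" by (auto simp: d1_def)
  hence "(\<lambda>_. 0) \<in> coboundaries2 G"
    using lin_closed_zero[OF lin_closed_cochains1] by (simp add: coboundaries2_def)
  ultimately show ?thesis by (simp add: lin_closed_def)
qed

section \<open>Cocycles supported on a single orbit\<close>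

lemma dual2_entry:
  assumes "a \<in> \<BB>" "b \<in> \<BB>"
  shows "entry (dual2 G c d) a b = (if c = d then if hdeg c = 1 then e a c * e b c else 0
    else e a c * e b d - (-1) ^ (hdeg c * hdeg d) * (e a d * e b c))"
  using assms by (simp add: dual2_def)

lemma dual2_cochains2:
  assumes "c \<in> \<BB>" "d \<in> \<BB>"
  shows "dual2 G c d \<in> cochains2 G"
proof -
  let ?s = "(-1) ^ (hdeg c * hdeg d) :: 'a"
  have pick: "(\<Sum>a\<in>\<BB>. \<Sum>b\<in>\<BB>. x a * y b * (e a u * e b v)) = x u * y v" if "u \<in> \<BB>" "v \<in> \<BB>"
    for x y :: "hidx \<Rightarrow> 'a" and u v
  proof -
    have "(\<Sum>a\<in>\<BB>. \<Sum>b\<in>\<BB>. x a * y b * (e a u * e b v)) = (\<Sum>a\<in>\<BB>. e u a * x a) * (\<Sum>b\<in>\<BB>. e v b * y b)"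
      unfolding sum_product by (intro sum.cong refl) (simp add: e_apply)
    thus ?thesis using that by (simp add: sum_e)
  qed
  have pick2: "(\<Sum>a\<in>\<BB>. \<Sum>b\<in>\<BB>. x a * y b * (e a c * e b d - ?s * (e a d * e b c))) =
      x c * y d - ?s * (x d * y c)" for x y
    using sum_sum_lincomb[of "\<lambda>a b. x a * y b * (e a c * e b d - ?s * (e a d * e b c))" 1
        "\<lambda>a b. x a * y b * (e a c * e b d)" "- ?s" "\<lambda>a b. x a * y b * (e a d * e b c)" "\<lambda>_. \<BB>" \<BB>]
      pick[OF assms] pick[OF assms(2,1)] by (simp add: algebra_simps)
  define M where "M a b = (if c = d then if hdeg c = 1 then e a c * e b c else 0
    else e a c * e b d - ?s * (e a d * e b c))" for a b
  have "dual2 G c d = bil M"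
    using pick[OF assms(1,1)] pick2 by (auto simp: fun_eq_iff dual2_def bil_def M_def)
  moreover have "bil M \<in> cochains2 G"
    by (rule bil_cochains2) (use hdeg_cases[of c] hdeg_cases[of d] in \<open>auto simp: M_def e_apply\<close>)
  ultimately show ?thesis by simp
qed

text \<open>Uniform description of the forms in \<open>A1\<close> to \<open>A5\<close>; for the last two families \<open>wt d = 0\<close>, and the
  division by zero removes the second term.\<close>

definition pform :: "hidx \<times> hidx \<Rightarrow> (hidx \<Rightarrow> 'a) \<times> (hidx \<Rightarrow> 'a) \<Rightarrow> 'a" where
  "pform = (\<lambda>(c, d) z. dual2 G c d z - wt c / wt d * dual2 G (sg c) (sg d) z)"

lemma e_mult_zero: "(a, b) \<noteq> (c, d) \<Longrightarrow> e a c * e b d = 0"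
  by (auto simp: e_apply)

lemma pform_cochains2: "c \<in> \<BB> \<Longrightarrow> d \<in> \<BB> \<Longrightarrow> pform (c, d) \<in> cochains2 G"
  unfolding pform_def prod.case
  by (intro lin_closed_diff lin_closed_scale lin_closed_cochains2 dual2_cochains2 sg_base)

text \<open>The factor \<open>1/2\<close> undoes the normalisation of \<open>dual2\<close> on the diagonal.\<close>

lemma pform_entry:
  assumes "a \<in> \<BB>" "b \<in> \<BB>" "c \<in> \<BB>" "d \<in> \<BB>"
  shows "entry (pform (c, d)) a b = (if c = d then 1 / 2 else 1) *
    ((e a c * e b d - (-1) ^ (hdeg c * hdeg d) * (e a d * e b c)) - wt c / wt d *
     (e a (sg c) * e b (sg d) - (-1) ^ (hdeg c * hdeg d) * (e a (sg d) * e b (sg c))))"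
proof -
  show ?thesis using assms two hdeg_cases[of c] hdeg_cases[of d]
    by (auto simp: pform_def dual2_entry[OF assms(1,2)] field_simps)
qed

text \<open>Both sides vanish unless \<open>a = sg c\<close>, and then the weights agree. This moves
  \<open>sg\<close> from an argument to the index of a coordinate function.\<close>

lemma wt_shift: "a \<in> \<BB> \<Longrightarrow> c \<in> \<BB> \<Longrightarrow> wt a * e (sg a) c = wt c * e a (sg c)"
  using sg_sg[of a] sg_sg[of c] wt_sg[of a] by (auto simp: e_apply)

lemma pform_cocycles2:
  assumes cd: "c \<in> \<BB>" "d \<in> \<BB>" "c \<noteq> z0" "d \<noteq> z0" and pm: "eq_pm (wt c) (wt d)"
  shows "pform (c, d) \<in> cocycles2 G"
proof (rule cocycleI[OF pform_cochains2[OF cd(1,2)]])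
  have sgz: "sg u \<noteq> z0" if "u \<in> \<BB>" "u \<noteq> z0" for u using that sg_sg[of u] sg_z0 by metis
  show "entry (pform (c, d)) z0 b = 0" if "b \<in> \<BB>" for b
    using that cd sgz by (simp add: pform_entry) (auto simp: e_apply)
  show "wt a * entry (pform (c, d)) (sg a) b + wt b * entry (pform (c, d)) a (sg b) = 0"
    if ab: "a \<in> \<BB>" "b \<in> \<BB>" for a b
  proof -
    define r where "r = wt c / wt d"
    define s where "s = ((-1) ^ (hdeg c * hdeg d) :: 'a)"
    define k where "k = (if c = d then 1 / 2 else 1 :: 'a)"
    \<comment> \<open>If \<open>wt d\<close> is nonzero then \<open>r\<close> is 1 or -1; otherwise
      both weights are zero, and so is \<open>r\<close> by the convention for division by
      zero.\<close>
    have r: "r * wt d = wt c" "r * wt c = wt d"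
      using pm by (auto simp: r_def eq_pm_def)
    have sh: "wt a * e (sg a) u = wt u * e a (sg u)" "wt a * e (sg a) (sg u) = wt u * e a u"
      "wt b * e (sg b) u = wt u * e b (sg u)" "wt b * e (sg b) (sg u) = wt u * e b u" if "u \<in> \<BB>" for u
      using that ab wt_shift[of a u] wt_shift[of a "sg u"] wt_shift[of b u] wt_shift[of b "sg u"] by auto
    \<comment> \<open>After the shifts every term carries one of the factors
      \<open>wt c - r * wt d\<close> and \<open>wt d - r * wt c\<close>, which are both
      zero.\<close>
    have "wt a * entry (pform (c, d)) (sg a) b + wt b * entry (pform (c, d)) a (sg b) = k *
      (((wt a * e (sg a) c) * e b d - s * ((wt a * e (sg a) d) * e b c))
       - r * ((wt a * e (sg a) (sg c)) * e b (sg d) - s * ((wt a * e (sg a) (sg d)) * e b (sg c)))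
       + (e a c * (wt b * e (sg b) d) - s * (e a d * (wt b * e (sg b) c)))
       - r * (e a (sg c) * (wt b * e (sg b) (sg d)) - s * (e a (sg d) * (wt b * e (sg b) (sg c)))))"
      using ab cd by (simp add: pform_entry r_def[symmetric] s_def[symmetric] k_def[symmetric] algebra_simps)
    also have "\<dots> = k *
      ((wt c - r * wt d) * (e a (sg c) * e b d) - s * ((wt d - r * wt c) * (e a (sg d) * e b c))
       + (wt d - r * wt c) * (e a c * e b (sg d)) - s * ((wt c - r * wt d) * (e a d * e b (sg c))))"
      unfolding sh[OF cd(1)] sh[OF cd(2)] by (simp add: algebra_simps)
    also have "\<dots> = 0" unfolding r by simp
    finally show ?thesis .
  qed
qed

text \<open>Selects one pair from each orbit under swapping and \<open>sg\<close> on which an invariant form can be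
  nonzero, except \<open>(Et t, Et t)\<close>, together with the pairs \<open>(D0, Et k)\<close>.\<close>

fun shape :: "hidx \<Rightarrow> hidx \<Rightarrow> bool" where
  "shape (Ev i) (Ev j) \<longleftrightarrow> 1 \<le> i \<and> i \<le> m \<and> (i < j \<and> j \<le> m \<or> m + i \<le> j \<and> j \<le> 2*m)"
| "shape (Ev i) (Om j) \<longleftrightarrow> 1 \<le> i \<and> i \<le> 2*m \<and> 1 \<le> j \<and> j \<le> n"
| "shape (Om i) (Om j) \<longleftrightarrow> 1 \<le> i \<and> i \<le> n \<and> (i \<le> j \<and> j \<le> n \<or> n + i < j \<and> j \<le> 2*n)"
| "shape (Et k) (Et l) \<longleftrightarrow> 1 \<le> k \<and> k \<le> l \<and> l \<le> t \<and> k < t"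
| "shape (Ev i) (Et k) \<longleftrightarrow> i = 2*m+2 \<and> 1 \<le> k \<and> k \<le> t"
| "shape _ _ \<longleftrightarrow> False"

lemma shape_base: "shape a b \<Longrightarrow> a \<in> \<BB> \<and> b \<in> \<BB> \<and> a \<noteq> z0 \<and> b \<noteq> z0"
  by (cases a; cases b) auto

text \<open>Together with \<open>shape_sg\<close> and \<open>shape_sg_swap\<close>: an orbit never
  contains two different selected pairs, so the form of one pivot vanishes at all others.\<close>

lemma shape_swap: "shape a b \<Longrightarrow> shape b a \<Longrightarrow> a = b"
  by (cases a; cases b) auto

lemma shape_sg: "shape a b \<Longrightarrow> shape (sg a) (sg b) \<Longrightarrow> sg a = a \<and> sg b = b \<and> wt a = 0"
  by (cases a; cases b) (auto split: if_splits)

lemma shape_sg_swap: "shape a b \<Longrightarrow> shape (sg b) (sg a) \<Longrightarrow> sg b = a \<and> sg a = b"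
  by (cases a; cases b) (auto split: if_splits)

text \<open>Reason for the strict bound \<open>n + i < j\<close> in \<open>shape\<close>: at
  \<open>(Om i, Om (n+i))\<close> the two terms of \<open>pform\<close> cancel.\<close>

lemma shape_sg_odd: "shape a b \<Longrightarrow> sg a = b \<Longrightarrow> hdeg a = 1 \<Longrightarrow> wt a = 0"
  by (cases a; cases b) (auto split: if_splits)

lemma shape_diag: "shape a a \<Longrightarrow> hdeg a = 1"
  by (cases a) auto

lemma wt_zero_iff: "a \<in> \<BB> \<Longrightarrow> wt a = 0 \<longleftrightarrow> a = z0 \<or> a = D0 \<or> (\<exists>k. a = Et k)"
  using lam kap by (elim baseE) auto

text \<open>The pairs at which a cocycle can be normalised to zero by a coboundary.\<close>

definition reduced :: "(hidx \<times> hidx) set" where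
  "reduced = {(Et t, Et t)} \<union> {(D0, b) | b. b \<in> \<BB> \<and> wt b \<noteq> 0}"

lemma shape_not_reduced:
  assumes "shape c d"
  shows "(c, d) \<notin> reduced" "(d, c) \<notin> reduced" "(sg c, sg d) \<notin> reduced" "(sg d, sg c) \<notin> reduced"
  using assms by (cases c; cases d; auto simp: reduced_def split: if_splits)+

text \<open>The two exceptions are harmless: a form is zero on an even vector paired with itself,
  and invariance with symmetry kills it at an odd pair \<open>(a, sg a)\<close> of nonzero
  weight.\<close>

lemma shape_cover:
  assumes "a \<in> \<BB>" "b \<in> \<BB>" "wt a \<noteq> 0" "wt b \<noteq> 0"
  shows "shape a b \<or> shape b a \<or> shape (sg a) (sg b) \<or> shape (sg b) (sg a) \<or>
    a = b \<and> hdeg a = 0 \<or> b = sg a \<and> hdeg a = 1"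
  using assms(3,4) by (cases rule: baseE[OF assms(1)]; cases rule: baseE[OF assms(2)]) auto

lemma cocycle_eq_zero:
  assumes \<phi>: "\<phi> \<in> cocycles2 G"
    and piv: "\<And>a b. shape a b \<Longrightarrow> eq_pm (wt a) (wt b) \<Longrightarrow> entry \<phi> a b = 0"
    and red: "\<And>a b. (a, b) \<in> reduced \<Longrightarrow> entry \<phi> a b = 0"
  shows "\<phi> = (\<lambda>_. 0)"
proof (rule cochains2_eqI[OF cocycles2_cochains2[OF \<phi>] lin_closed_zero[OF lin_closed_cochains2]])
  note c2 = cocycles2_cochains2[OF \<phi>]
  have swap: "entry \<phi> a b = 0" if "entry \<phi> b a = 0" "a \<in> \<BB>" "b \<in> \<BB>" for a b
    using entry_skew[OF c2 that(2,3)] that(1) by simp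
  have inv: "wt a * entry \<phi> (sg a) (sg b) + wt b * entry \<phi> a b = 0"
    if "a \<in> \<BB>" "b \<in> \<BB>" "a \<noteq> D0" "b \<noteq> D0" for a b
    using cocycle_invariant[OF \<phi>, of a "sg b"] that by simp
  have D: "entry \<phi> D0 b = 0" if "b \<in> \<BB>" for b
  proof (cases "wt b = 0")
    case True
    with that consider "b = z0" | "b = D0" | k where "b = Et k" by (auto simp: wt_zero_iff)
    thus ?thesis
    proof cases
      case 1
      thus ?thesis using swap[of z0 D0] cocycle_central[OF \<phi>, of D0] swap[of D0 z0] by simp
    next
      case 2
      thus ?thesis using entry_even_diag[OF c2, of D0] by simp
    next
      case 3
      thus ?thesis using piv[of D0 b] that by (simp add: D0_def eq_pm_def)
    qed
  next
    case False
    thus ?thesis using that by (intro red) (auto simp: reduced_def)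
  qed
  fix a b assume ab: "a \<in> \<BB>" "b \<in> \<BB>"
  show "entry \<phi> a b = 0"
  proof (cases "a \<in> {z0, D0} \<or> b \<in> {z0, D0}")
    case True
    thus ?thesis using D cocycle_central[OF \<phi>] swap ab by auto
  next
    case False
    hence nD: "a \<noteq> D0" "b \<noteq> D0" and nz: "a \<noteq> z0" "b \<noteq> z0" by auto
    have i1: "wt a * entry \<phi> (sg a) (sg b) + wt b * entry \<phi> a b = 0"
      using inv ab nD by simp
    have i2: "wt a * entry \<phi> a b + wt b * entry \<phi> (sg a) (sg b) = 0"
      using inv[of "sg a" "sg b"] ab nD by simp
    consider "wt a = 0" "wt b = 0" | "wt a = 0" "wt b \<noteq> 0" | "wt a \<noteq> 0" "wt b = 0"
      | "wt a \<noteq> 0" "wt b \<noteq> 0" "\<not> eq_pm (wt a) (wt b)" | "wt a \<noteq> 0" "wt b \<noteq> 0" "eq_pm (wt a) (wt b)"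
      by blast
    thus ?thesis
    proof cases
      case 1
      then obtain k l where kl: "a = Et k" "b = Et l" using ab nD nz by (auto simp: wt_zero_iff)
      \<comment> \<open>The pair excluded from \<open>shape\<close> here is the one listed in
        \<open>reduced\<close>.\<close>
      have "k = t \<and> l = t \<or> shape a b \<or> shape b a" using ab kl by auto
      thus ?thesis
        using piv[of a b] piv[of b a] red[of a b] swap[OF _ ab] 1 kl
        by (auto simp: eq_pm_def reduced_def)
    next
      case 4
      \<comment> \<open>Elimination of the value at \<open>(sg a, sg b)\<close> from
        \<open>i1\<close> and \<open>i2\<close>; the factor on the left is their determinant up to
        sign.\<close>
      have "(wt a * wt a - wt b * wt b) * entry \<phi> a b =
          wt a * (wt a * entry \<phi> a b + wt b * entry \<phi> (sg a) (sg b))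
          - wt b * (wt a * entry \<phi> (sg a) (sg b) + wt b * entry \<phi> a b)"
        by (simp add: algebra_simps)
      also have "\<dots> = 0" unfolding i1 i2 by simp
      finally show ?thesis using 4(3) by (auto simp: eq_pm_def square_eq_iff)
    next
      case 5
      have pm': "eq_pm (wt b) (wt a)" using 5(3) by (auto simp: eq_pm_def)
      have red1: ?thesis if "entry \<phi> (sg a) (sg b) = 0" using i1 that 5 by simp
      from shape_cover[OF ab 5(1,2)] consider "shape a b" | "shape b a" | "shape (sg a) (sg b)"
        | "shape (sg b) (sg a)" | "a = b" "hdeg a = 0" | "b = sg a" "hdeg a = 1" by auto
      thus ?thesis
      proof cases
        case 1 thus ?thesis using piv 5 by simp
      next
        case 2 thus ?thesis using piv[OF 2 pm'] swap ab by simp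
      next
        case 3 thus ?thesis using piv[OF 3] 5 ab red1 by simp
      next
        case 4
        have "entry \<phi> (sg b) (sg a) = 0" using piv[OF 4] pm' ab by simp
        from swap[OF this] show ?thesis using ab red1 by simp
      next
        case 5 thus ?thesis using entry_even_diag[OF c2 ab(1)] by simp
      next
        case 6
        have "entry \<phi> (sg a) a = entry \<phi> a (sg a)"
          using entry_odd_sym[OF c2, of "sg a" a] ab 6 by simp
        hence "2 * (wt a * entry \<phi> a b) = 0" using i1 6 ab by simp
        thus ?thesis using two 5 by simp
      qed
    \<comment> \<open>When exactly one weight is zero, \<open>i1\<close> or \<open>i2\<close>
      reduces to the other weight times the value at \<open>(a, b)\<close>.\<close>
    qed (use i1 i2 in auto)
  qed
qed

text \<open>The last two conclusions express everything on which \<open>d1 G \<psi>\<close> depends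
  through values of \<open>\<phi>\<close>; they later show that the coboundary inherits the parity
  of \<open>\<phi>\<close>.\<close>

lemma match_reduced:
  assumes \<phi>: "\<phi> \<in> cocycles2 G"
  obtains \<psi> where "\<psi> \<in> cochains1 G" "\<And>a b. (a, b) \<in> reduced \<Longrightarrow> entry (d1 G \<psi>) a b = entry \<phi> a b"
    "\<psi> (e z0) = entry \<phi> (Et t) (Et t)" "\<And>b. b \<in> \<BB> \<Longrightarrow> wt b * \<psi> (e (sg b)) = of_bool (wt b \<noteq> 0) * entry \<phi> D0 b"
proof -
  \<comment> \<open>The values solve \<open>d1 G \<psi> = \<phi>\<close> on \<open>reduced\<close>:
    the bracket of \<open>Et t\<close> with itself is z, and \<open>[D0, sg b]\<close> is
    \<open>wt b\<close> times \<open>b\<close>.\<close>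
  define c where "c b = (if b = z0 then entry \<phi> (Et t) (Et t) else if wt b = 0 then 0 else entry \<phi> D0 (sg b) / wt b)" for b
  define \<psi> where "\<psi> = (\<lambda>x. if x \<in> vecs G then \<Sum>a\<in>\<BB>. x a * c a else 0)"
  have \<psi>: "\<psi> \<in> cochains1 G" unfolding \<psi>_def by (rule cochains1_of_coeffs)
  have e: "\<psi> (e b) = c b" if "b \<in> \<BB>" for b using that by (simp add: \<psi>_def sum_e)
  have 1: "\<psi> (e z0) = entry \<phi> (Et t) (Et t)" by (simp add: e c_def)
  have 2: "wt b * \<psi> (e (sg b)) = of_bool (wt b \<noteq> 0) * entry \<phi> D0 b" if "b \<in> \<BB>" for b
  proof (cases "wt b = 0")
    case False
    hence "sg b \<noteq> z0" using wt_sg[OF that] wt_z0 by metis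
    thus ?thesis using that False by (simp add: e c_def)
  qed simp
  have "entry (d1 G \<psi>) a b = entry \<phi> a b" if "(a, b) \<in> reduced" for a b
    using that t 1 2[of b] by (auto simp: reduced_def d1_entry[OF \<psi>])
  with \<psi> 1 2 show ?thesis using that by blast
qed

text \<open>\<open>d1 G \<psi>\<close> depends only on \<open>\<psi> (e z0)\<close> and the products
  \<open>wt b * \<psi> (e (sg b))\<close>, and these are its values on \<open>reduced\<close>
  wherever they are not trivially zero.\<close>

lemma coboundary_eq_zero:
  assumes "\<phi> \<in> coboundaries2 G" and red: "\<And>a b. (a, b) \<in> reduced \<Longrightarrow> entry \<phi> a b = 0"
  shows "\<phi> = (\<lambda>_. 0)"
proof -
  obtain \<psi> where \<psi>: "\<psi> \<in> cochains1 G" "\<phi> = d1 G \<psi>" using assms(1) by (auto simp: coboundaries2_def)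
  have z: "\<psi> (e z0) = 0" using red[of "Et t" "Et t"] t by (simp add: \<psi> d1_entry[OF \<psi>(1)] reduced_def)
  have s: "wt b * \<psi> (e (sg b)) = 0" if "b \<in> \<BB>" for b
    using red[of D0 b] that by (cases "wt b = 0") (auto simp: \<psi> d1_entry[OF \<psi>(1)] reduced_def)
  show ?thesis
    by (rule cochains2_eqI[OF _ lin_closed_zero[OF lin_closed_cochains2]])
      (use s in \<open>auto simp: \<psi>(2) d1_cochains2[OF \<psi>(1)] d1_entry[OF \<psi>(1)] z\<close>)
qed

definition pivots :: "nat set \<Rightarrow> (hidx \<times> hidx) set" where
  "pivots K = {(a, b). shape a b \<and> eq_pm (wt a) (wt b) \<and> (hdeg a + hdeg b) mod 2 \<in> K}"

lemma finite_pivots: "finite (pivots K)"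
  by (rule finite_subset[of _ "\<BB> \<times> \<BB>"]) (use shape_base finite_base in \<open>auto simp: pivots_def\<close>)

text \<open>\<open>pform (c, d)\<close> is supported on the orbit of \<open>(c, d)\<close>, which
  contains no other selected pair and no reduced pair. What remains is that its terms do not cancel
  at the pivot.\<close>

lemma pform_pivot:
  assumes cd: "shape c d" "eq_pm (wt c) (wt d)"
  shows "entry (pform (c, d)) c d \<noteq> 0"
    and "shape a b \<Longrightarrow> (a, b) \<noteq> (c, d) \<Longrightarrow> entry (pform (c, d)) a b = 0"
    and "(a, b) \<in> reduced \<Longrightarrow> entry (pform (c, d)) a b = 0"
proof -
  have b: "c \<in> \<BB>" "d \<in> \<BB>" using shape_base[OF cd(1)] by auto
  note sd = sg_sg[OF b(2)]
  have off: "entry (pform (c, d)) a b = 0"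
    if "a \<in> \<BB>" "b \<in> \<BB>" "(a, b) \<noteq> (c, d)" "(a, b) \<noteq> (d, c)"
      "wt c \<noteq> 0 \<Longrightarrow> (a, b) \<noteq> (sg c, sg d)" "wt c \<noteq> 0 \<Longrightarrow> (a, b) \<noteq> (sg d, sg c)" for a b
  proof (cases "wt c = 0")
    case True
    show ?thesis unfolding pform_entry[OF that(1,2) b] that(3,4)[THEN e_mult_zero] True by simp
  next
    case False
    show ?thesis unfolding pform_entry[OF that(1,2) b] that(3,4)[THEN e_mult_zero]
        that(5,6)[OF False, THEN e_mult_zero] by simp
  qed
  show "entry (pform (c, d)) a b = 0" if "shape a b" "(a, b) \<noteq> (c, d)"
  proof (rule off)
    show "(a, b) \<noteq> (d, c)" using shape_swap[OF cd(1)] that by auto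
    show "(a, b) \<noteq> (sg c, sg d)" using shape_sg[OF cd(1)] that by auto
    show "(a, b) \<noteq> (sg d, sg c)" using shape_sg_swap[OF cd(1)] that by auto
  qed (use shape_base[OF that(1)] that in auto)
  show "entry (pform (c, d)) a b = 0" if "(a, b) \<in> reduced"
  proof (rule off)
    show "a \<in> \<BB>" "b \<in> \<BB>" using that t by (auto simp: reduced_def)
  qed (use that shape_not_reduced[OF cd(1)] in metis)+
  \<comment> \<open>Cancellation is possible only if \<open>(c, d)\<close> coincides with one of its
    images: \<open>c = d\<close>, both fixed by \<open>sg\<close>, or \<open>c = sg d\<close>. The
    value is 2 in the last case with nonzero weight, and 1 otherwise.\<close>
  show "entry (pform (c, d)) c d \<noteq> 0"
  proof (cases "c = d")
    case True
    have "hdeg d = 1" using shape_diag cd(1) True by simp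
    moreover have "d = sg d \<Longrightarrow> wt d = 0" using shape_sg[OF cd(1)] cd(1) True by auto
    ultimately show ?thesis using True b two by (auto simp: pform_entry e_apply)
  next
    case False
    show ?thesis
    proof (cases "wt c = 0")
      case True
      thus ?thesis using False b by (simp add: pform_entry e_apply)
    next
      case wc: False
      have 1: "\<not> (c = sg c \<and> d = sg d)" using shape_sg[OF cd(1)] cd(1) wc by auto
      show ?thesis
      proof (cases "c = sg d")
        case True
        hence d: "d = sg c" using sd by simp
        \<comment> \<open>For odd \<open>c\<close> the second term would cancel the first; for even
          \<open>c\<close> skewness makes it a second copy.\<close>
        have h: "hdeg c = 0" using shape_sg_odd[OF cd(1)] d wc hdeg_cases[of c] by auto
        have "wt c = wt d" using d b by simp
        thus ?thesis using d h False b wc two 1 by (simp add: pform_entry) (auto simp: e_apply)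
      next
        case nsg: False
        thus ?thesis using False b 1 by (auto simp: pform_entry e_apply)
      qed
    qed
  qed
qed

lemma pform_parity:
  assumes "a \<in> \<BB>" "b \<in> \<BB>" "c \<in> \<BB>" "d \<in> \<BB>" "(hdeg a + hdeg b) mod 2 \<noteq> (hdeg c + hdeg d) mod 2"
  shows "entry (pform (c, d)) a b = 0"
proof -
  have *: "(a, b) \<noteq> (c, d)" "(a, b) \<noteq> (d, c)" "(a, b) \<noteq> (sg c, sg d)" "(a, b) \<noteq> (sg d, sg c)"
    using assms(5) by (auto simp: add.commute)
  show ?thesis unfolding pform_entry[OF assms(1-4)] *[THEN e_mult_zero] by simp
qed

text \<open>\<open>X\<close> stands for a parity condition readable off the entries through
  \<open>K\<close>: all of \<open>UNIV\<close> for \<open>K = {0,1}\<close>, or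
  \<open>parity2 G s\<close> for \<open>K = {s}\<close>.\<close>

lemma H2_basis:
  assumes X: "lin_closed X"
    and XK: "\<And>\<phi>. \<phi> \<in> cochains2 G \<Longrightarrow>
      \<phi> \<in> X \<longleftrightarrow> (\<forall>a\<in>\<BB>. \<forall>b\<in>\<BB>. (hdeg a + hdeg b) mod 2 \<notin> K \<longrightarrow> entry \<phi> a b = 0)"
  shows "LinearCombinations.module.span class_ring (quotient_space (cocycles2 G \<inter> X) (coboundaries2 G))
      (coset (coboundaries2 G) ` pform ` pivots K) = carrier (quotient_space (cocycles2 G \<inter> X) (coboundaries2 G))"
    and "vectorspace.dim class_ring (quotient_space (cocycles2 G \<inter> X) (coboundaries2 G)) = card (pivots K)"
proof -
  interpret quotient "cocycles2 G \<inter> X" "coboundaries2 G"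
    by unfold_locales (simp_all add: lin_closed_Int X lin_closed_cocycles2 lin_closed_coboundaries2)
  let ?pt = "\<lambda>(a, b). (e a, e b)"
  have *: "pform p \<in> cocycles2 G \<inter> X" if "p \<in> pivots K" for p
  proof -
    obtain c d where p: "p = (c, d)" by (cases p)
    hence cd: "c \<in> \<BB>" "d \<in> \<BB>" "c \<noteq> z0" "d \<noteq> z0" "eq_pm (wt c) (wt d)" "(hdeg c + hdeg d) mod 2 \<in> K"
      using that shape_base[of c d] by (auto simp: pivots_def)
    have "pform p \<in> X"
      unfolding p XK[OF pform_cochains2[OF cd(1,2)]] using pform_parity[OF _ _ cd(1,2)] cd(6) by metis
    thus ?thesis using pform_cocycles2[OF cd(1-5)] by (simp add: p)
  qed
  have "V.span (coset (coboundaries2 G) ` pform ` pivots K) = carrier Q \<and> V.dim = card (pivots K)"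
  proof (rule basis_by_evaluation[where pt = ?pt and R = "?pt ` reduced"])
    fix f assume f: "f \<in> cocycles2 G \<inter> X"
    obtain \<psi> where \<psi>: "\<psi> \<in> cochains1 G" "\<And>a b. (a, b) \<in> reduced \<Longrightarrow> entry (d1 G \<psi>) a b = entry f a b"
      "\<psi> (e z0) = entry f (Et t) (Et t)" "\<And>b. b \<in> \<BB> \<Longrightarrow> wt b * \<psi> (e (sg b)) = of_bool (wt b \<noteq> 0) * entry f D0 b"
      using match_reduced f by blast
    have fX: "entry f a b = 0" if "a \<in> \<BB>" "b \<in> \<BB>" "(hdeg a + hdeg b) mod 2 \<notin> K" for a b
      using f XK[of f] that cocycles2_cochains2[of f] by blast
    have "d1 G \<psi> \<in> X"
      unfolding XK[OF d1_cochains2[OF \<psi>(1)]]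
    proof (intro ballI impI)
      fix a b assume ab: "a \<in> \<BB>" "b \<in> \<BB>" and par: "(hdeg a + hdeg b) mod 2 \<notin> K"
      have "bt a b = 0 \<or> hdeg a = hdeg b" by (cases a; cases b) auto
      hence "bt a b * entry f (Et t) (Et t) = 0"
        using fX[of "Et t" "Et t"] par t by (auto simp: mult_2[symmetric])
      thus "entry (d1 G \<psi>) a b = 0"
        using fX[of D0 b] fX[of D0 a] par ab by (auto simp: d1_entry[OF \<psi>(1)] \<psi>(3,4))
    qed
    thus "\<exists>b\<in>coboundaries2 G \<inter> (cocycles2 G \<inter> X). \<forall>r\<in>?pt ` reduced. b r = f r"
      using \<psi>(1,2) by (intro bexI[of _ "d1 G \<psi>"]) (auto simp: coboundaries2_def d1_cocycles2)
  next
    fix f assume f: "f \<in> cocycles2 G \<inter> X" "\<And>i. i \<in> pivots K \<Longrightarrow> f (?pt i) = 0" "\<And>r. r \<in> ?pt ` reduced \<Longrightarrow> f r = 0"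
    have fX: "entry f a b = 0" if "a \<in> \<BB>" "b \<in> \<BB>" "(hdeg a + hdeg b) mod 2 \<notin> K" for a b
      using f XK[of f] that cocycles2_cochains2[of f] by blast
    show "f = (\<lambda>_. 0)"
    proof (rule cocycle_eq_zero)
      show "f \<in> cocycles2 G" using f by simp
      show "entry f a b = 0" if "shape a b" "eq_pm (wt a) (wt b)" for a b
        using that f(2)[of "(a, b)"] fX[of a b] shape_base[of a b] by (auto simp: pivots_def)
      show "entry f a b = 0" if "(a, b) \<in> reduced" for a b
        using f(3)[of "(e a, e b)"] that by force
    qed
  next
    fix b assume b: "b \<in> coboundaries2 G" "\<And>r. r \<in> ?pt ` reduced \<Longrightarrow> b r = 0"
    show "b = (\<lambda>_. 0)"
      by (rule coboundary_eq_zero[OF b(1)]) (use b(2) in force)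
  next
    show "pform i (?pt i) \<noteq> 0" if "i \<in> pivots K" for i
      using that pform_pivot(1) by (auto simp: pivots_def)
    show "pform i (?pt j) = 0" if "i \<in> pivots K" "j \<in> pivots K" "i \<noteq> j" for i j
      using that pform_pivot(2) by (cases i; cases j) (auto simp: pivots_def)
    show "pform i r = 0" if "i \<in> pivots K" "r \<in> ?pt ` reduced" for i r
      using that pform_pivot(3) by (auto simp: pivots_def)
  qed (use * finite_pivots in auto)
  thus "V.span (coset (coboundaries2 G) ` pform ` pivots K) = carrier Q" "V.dim = card (pivots K)"
    by auto
qed

section \<open>Spanning sets and dimensions\<close>

text \<open>A 1-cocycle is a linear form that kills the derived algebra. That is spanned by z, which
  is \<open>[Et 1, Et 1]\<close>, and by the basis vectors of nonzero weight, each a multiple of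
  some \<open>[D0, sg b]\<close>; \<open>I\<close> is what is left.\<close>

lemma H1_basis:
  defines "I \<equiv> insert D0 (Et ` {1..t})"
  shows "I \<subseteq> \<BB>" and "b \<in> I \<Longrightarrow> dual1 G b \<in> cocycles1 G"
    and "LinearCombinations.module.span class_ring (H1 G) (coset (coboundaries1 G) ` dual1 G ` I) = carrier (H1 G)"
proof -
  have cob: "coboundaries1 G = {\<lambda>_. 0}" by (auto simp: coboundaries1_def d0_def)
  have coc: "\<psi> \<in> cocycles1 G \<longleftrightarrow> \<psi> \<in> cochains1 G \<and> (\<forall>b\<in>\<BB> - I. \<psi> (e b) = 0)" for \<psi>
  proof (cases "\<psi> \<in> cochains1 G")
    case \<psi>: True
    have "\<psi> \<in> cocycles1 G \<longleftrightarrow> (\<forall>a\<in>\<BB>. \<forall>b\<in>\<BB>. entry (d1 G \<psi>) a b = 0)"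
      using \<psi> cochains2_eqI[OF d1_cochains2[OF \<psi>] lin_closed_zero[OF lin_closed_cochains2]]
      by (auto simp: cocycles1_def)
    also have "\<dots> \<longleftrightarrow> (\<forall>b\<in>\<BB> - I. \<psi> (e b) = 0)"
    proof
      assume *: "\<forall>a\<in>\<BB>. \<forall>b\<in>\<BB>. entry (d1 G \<psi>) a b = 0"
      have "\<psi> (e b) = 0" if b: "b \<in> \<BB>" "b \<notin> I" for b
      proof (cases "b = z0")
        case True
        thus ?thesis using *[rule_format, of "Et 1" "Et 1"] t by (simp add: d1_entry[OF \<psi>])
      next
        case False
        hence "wt b \<noteq> 0" using b by (auto simp: wt_zero_iff I_def)
        moreover have "b \<noteq> D0" using b by (auto simp: I_def)
        ultimately show ?thesis using *[rule_format, of D0 "sg b"] b by (simp add: d1_entry[OF \<psi>])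
      qed
      thus "\<forall>b\<in>\<BB> - I. \<psi> (e b) = 0" by blast
    next
      assume *: "\<forall>b\<in>\<BB> - I. \<psi> (e b) = 0"
      have "wt b * \<psi> (e (sg b)) = 0" if "b \<in> \<BB>" for b
      proof (cases "wt b = 0")
        case False
        hence "wt (sg b) \<noteq> 0" using that by simp
        hence "sg b \<notin> I" by (auto simp: I_def)
        thus ?thesis using * that by simp
      qed simp
      moreover have "\<psi> (e z0) = 0" using * by (auto simp: I_def)
      ultimately show "\<forall>a\<in>\<BB>. \<forall>b\<in>\<BB>. entry (d1 G \<psi>) a b = 0"
        by (auto simp: d1_entry[OF \<psi>])
    qed
    finally show ?thesis using \<psi> by blast
  qed (auto simp: cocycles1_def)
  have lin: "lin_closed (cocycles1 G)"
    using lin_closed_cochains1 by (simp add: lin_closed_def coc)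
  show I: "I \<subseteq> \<BB>" by (auto simp: I_def)
  have fin: "finite I" by (simp add: I_def)
  have val: "dual1 G b (e a) = e a b" if "a \<in> \<BB>" for a b using that by (simp add: dual1_def)
  show F: "dual1 G b \<in> cocycles1 G" if "b \<in> I" for b
  proof -
    have "dual1 G b \<in> cochains1 G"
      using that I by (auto simp: cochains1_def linear_form_on_def dual1_def vecs_iff)
    thus ?thesis using that I by (auto simp: coc val e_apply)
  qed
  interpret quotient "cocycles1 G" "coboundaries1 G"
    by unfold_locales (simp_all add: lin cob, simp add: lin_closed_def)
  have "V.span (coset (coboundaries1 G) ` dual1 G ` I) = carrier Q \<and> V.dim = card I"
  proof (rule basis_by_evaluation[where pt = e and R = "{}"])
    fix f assume f: "f \<in> cocycles1 G" "\<And>i. i \<in> I \<Longrightarrow> f (e i) = 0"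
    hence "f \<in> cochains1 G" "f (e b) = 0" if "b \<in> \<BB>" for b using that by (auto simp: coc)
    hence "f x = 0" for x using cochains1_expand[of f x] f(1)
      by (cases "x \<in> vecs G") (auto simp: coc cochains1_def)
    thus "f = (\<lambda>_. 0)" by auto
  next
    show "dual1 G i (e i) \<noteq> 0" if "i \<in> I" for i using that I by (simp add: val e_apply subset_iff)
    show "dual1 G i (e j) = 0" if "i \<in> I" "j \<in> I" "i \<noteq> j" for i j
      using that I by (simp add: val e_apply subset_iff)
    show "\<exists>b\<in>coboundaries1 G \<inter> cocycles1 G. \<forall>r\<in>{}. b r = f r" for f
      using lin_closed_zero[OF lin] by (auto simp: cob)
  qed (use F fin in \<open>auto simp: cob\<close>)
  thus "LinearCombinations.module.span class_ring (H1 G) (coset (coboundaries1 G) ` dual1 G ` I) = carrier (H1 G)"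
    by (simp add: H1_def)
qed

section \<open>The families A1 to A5 as orbit forms\<close>

lemma dual2_swap: "c \<noteq> d \<Longrightarrow> dual2 G c d z = - ((-1) ^ (hdeg c * hdeg d)) * dual2 G d c z"
  using hdeg_cases[of c] hdeg_cases[of d] by (cases z) (auto simp: dual2_def)

text \<open>In the second and sixth clause \<open>sg\<close> returns the second term in reversed
  order; reordering turns its sign into plus for even vectors and leaves it for odd ones.\<close>

lemma pform_simps:
  assumes "1 \<le> i"
  shows "i \<le> m \<Longrightarrow> 1 \<le> j \<Longrightarrow> j \<le> m \<Longrightarrow>
      pform (Ev i, Ev j) z = dual2 G (Ev i) (Ev j) z - lam i / lam j * dual2 G (Ev (m+i)) (Ev (m+j)) z"
    and "i \<le> m \<Longrightarrow> 1 \<le> j \<Longrightarrow> j \<le> m \<Longrightarrow>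
      pform (Ev i, Ev (m+j)) z = dual2 G (Ev i) (Ev (m+j)) z + lam i / lam j * dual2 G (Ev j) (Ev (m+i)) z"
    and "i \<le> m \<Longrightarrow> 1 \<le> j \<Longrightarrow> j \<le> n \<Longrightarrow>
      pform (Ev (m+i), Om j) z = dual2 G (Ev (m+i)) (Om j) z - lam i / kap j * dual2 G (Ev i) (Om (n+j)) z"
    and "i \<le> m \<Longrightarrow> 1 \<le> j \<Longrightarrow> j \<le> n \<Longrightarrow>
      pform (Ev i, Om j) z = dual2 G (Ev i) (Om j) z - lam i / kap j * dual2 G (Ev (m+i)) (Om (n+j)) z"
    and "i \<le> n \<Longrightarrow> 1 \<le> j \<Longrightarrow> j \<le> n \<Longrightarrow>
      pform (Om i, Om j) z = dual2 G (Om i) (Om j) z - kap i / kap j * dual2 G (Om (n+i)) (Om (n+j)) z"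
    and "i \<le> n \<Longrightarrow> 1 \<le> j \<Longrightarrow> j \<le> n \<Longrightarrow>
      pform (Om i, Om (n+j)) z = dual2 G (Om i) (Om (n+j)) z - kap i / kap j * dual2 G (Om j) (Om (n+i)) z"
    and "pform (c, Et k) = dual2 G c (Et k)"
  using assms dual2_swap[of "Ev (m+i)" "Ev j" z] dual2_swap[of "Om (n+i)" "Om j" z]
  by (auto simp: pform_def)

lemma A_eq:
  "A1 G m lam = (\<Union>i\<in>{1..m}. \<Union>j\<in>{i..m}.
     {\<lambda>z. of_bool (eq_pm (lam i) (lam j)) * pform (Ev i, Ev j) z,
      \<lambda>z. of_bool (eq_pm (lam i) (lam j)) * pform (Ev i, Ev (m+j)) z})"
  "A2 G m n lam kap = (\<Union>i\<in>{1..m}. \<Union>j\<in>{1..n}.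
     {\<lambda>z. of_bool (eq_pm (lam i) (kap j)) * pform (Ev (m+i), Om j) z,
      \<lambda>z. of_bool (eq_pm (lam i) (kap j)) * pform (Ev i, Om j) z})"
  "A3 G n kap = (\<Union>i\<in>{1..n}. \<Union>j\<in>{i..n}.
     {\<lambda>z. of_bool (eq_pm (kap i) (kap j)) * pform (Om i, Om j) z,
      \<lambda>z. of_bool (eq_pm (kap i) (kap j)) * pform (Om i, Om (n+j)) z})"
  "A4 G t = {pform (Et i, Et i) | i. 1 \<le> i \<and> i \<le> t - 1} \<union> {pform (Et k, Et l) | k l. 1 \<le> k \<and> k < l \<and> l \<le> t}"
  "A5 G m t = {pform (D0, Et k) | k. 1 \<le> k \<and> k \<le> t}"
  unfolding A1_def A2_def A3_def A4_def A5_def D0_def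
  by (auto simp: pform_simps intro!: SUP_cong)

abbreviation "AA \<equiv> A1 G m lam \<union> A2 G m n lam kap \<union> A3 G n kap \<union> A4 G t \<union> A5 G m t"

lemma AA_cocycles2: "AA \<subseteq> cocycles2 G"
proof -
  have "(\<lambda>z. of_bool P * pform (c, d) z) \<in> cocycles2 G"
    if "c \<in> \<BB>" "d \<in> \<BB>" "c \<noteq> z0" "d \<noteq> z0" "P \<Longrightarrow> eq_pm (wt c) (wt d)" for P c d
    using pform_cocycles2[OF that(1-4)] that(5) lin_closed_zero[OF lin_closed_cocycles2] by (cases P) auto
  moreover have "pform (c, Et k) \<in> cocycles2 G" if "c \<in> \<BB>" "c \<noteq> z0" "1 \<le> k" "k \<le> t" "wt c = 0" for c k
    using that by (intro pform_cocycles2) (auto simp: eq_pm_def)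
  ultimately show ?thesis by (auto simp: A_eq)
qed

text \<open>Inversion into the index families of \<open>A1\<close> to \<open>A5\<close>, used both
  for the inclusion of the forms and for counting.\<close>

lemma shapeE:
  assumes "shape a b"
  obtains i j where "a = Ev i" "b = Ev j" "1 \<le> i" "i < j" "j \<le> m"
  | i j where "a = Ev i" "b = Ev (m+j)" "1 \<le> i" "i \<le> j" "j \<le> m"
  | i j where "a = Ev i" "b = Om j" "1 \<le> i" "i \<le> m" "1 \<le> j" "j \<le> n"
  | i j where "a = Ev (m+i)" "b = Om j" "1 \<le> i" "i \<le> m" "1 \<le> j" "j \<le> n"
  | i j where "a = Om i" "b = Om j" "1 \<le> i" "i \<le> j" "j \<le> n"
  | i j where "a = Om i" "b = Om (n+j)" "1 \<le> i" "i < j" "j \<le> n"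
  | k l where "a = Et k" "b = Et l" "1 \<le> k" "k \<le> l" "l \<le> t" "k < t"
  | k where "a = D0" "b = Et k" "1 \<le> k" "k \<le> t"
proof (cases a)
  case (Ev i)
  show ?thesis
  proof (cases b)
    case (Ev j)
    thus ?thesis using assms \<open>a = Ev i\<close> that(1)[of i j] that(2)[of i "j-m"] by (cases "j \<le> m") auto
  next
    case (Om j)
    thus ?thesis using assms \<open>a = Ev i\<close> that(3)[of i j] that(4)[of "i-m" j] by (cases "i \<le> m") auto
  next
    case (Et k)
    thus ?thesis using assms \<open>a = Ev i\<close> that(8)[of k] by auto
  qed
next
  case (Om i)
  thus ?thesis
  proof (cases b)
    case (Om j)
    thus ?thesis using assms \<open>a = Om i\<close> that(5)[of i j] that(6)[of i "j-n"] by (cases "j \<le> n") auto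
  qed (use assms in auto)
next
  case (Et k)
  thus ?thesis using assms that(7) by (cases b) auto
qed

text \<open>Only an inclusion holds in general, because \<open>AA\<close> may also contain the zero
  form: from pairs with the weight condition false, from \<open>(Ev i, Ev i)\<close> and from
  \<open>(Om i, Om (n+i))\<close>.\<close>

lemma pivots_AA: "pform ` pivots K \<subseteq> AA"
proof -
  have "pform (a, b) \<in> AA" if s: "shape a b" and pm: "eq_pm (wt a) (wt b)" for a b
  proof -
    have one: "f \<in> S" if "(\<lambda>z. of_bool P * f z) \<in> S" P for f :: "_ \<Rightarrow> 'a" and P S
      using that by simp
    consider (1) i j where "a = Ev i" "b = Ev j" "1 \<le> i" "i < j" "j \<le> m"
      | (2) i j where "a = Ev i" "b = Ev (m+j)" "1 \<le> i" "i \<le> j" "j \<le> m"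
      | (3) i j where "a = Ev i" "b = Om j" "1 \<le> i" "i \<le> m" "1 \<le> j" "j \<le> n"
      | (4) i j where "a = Ev (m+i)" "b = Om j" "1 \<le> i" "i \<le> m" "1 \<le> j" "j \<le> n"
      | (5) i j where "a = Om i" "b = Om j" "1 \<le> i" "i \<le> j" "j \<le> n"
      | (6) i j where "a = Om i" "b = Om (n+j)" "1 \<le> i" "i < j" "j \<le> n"
      | (7) k l where "a = Et k" "b = Et l" "1 \<le> k" "k \<le> l" "l \<le> t" "k < t"
      | (8) k where "a = D0" "b = Et k" "1 \<le> k" "k \<le> t"
      using s by (rule shapeE) blast+
    thus ?thesis
    proof cases
      case 1
      have "(\<lambda>z. of_bool (eq_pm (lam i) (lam j)) * pform (a, b) z) \<in> A1 G m lam"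
        unfolding A_eq using 1 by (intro UN_I[of i] UN_I[of j]) auto
      thus ?thesis using pm 1 by (auto dest: one)
    next
      case 2
      have "(\<lambda>z. of_bool (eq_pm (lam i) (lam j)) * pform (a, b) z) \<in> A1 G m lam"
        unfolding A_eq using 2 by (intro UN_I[of i] UN_I[of j]) auto
      thus ?thesis using pm 2 by (auto dest: one)
    next
      case 3
      have "(\<lambda>z. of_bool (eq_pm (lam i) (kap j)) * pform (a, b) z) \<in> A2 G m n lam kap"
        unfolding A_eq using 3 by (intro UN_I[of i] UN_I[of j]) auto
      thus ?thesis using pm 3 by (auto dest: one)
    next
      case 4
      have "(\<lambda>z. of_bool (eq_pm (lam i) (kap j)) * pform (a, b) z) \<in> A2 G m n lam kap"
        unfolding A_eq using 4 by (intro UN_I[of i] UN_I[of j]) auto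
      thus ?thesis using pm 4 by (auto dest: one)
    next
      case 5
      have "(\<lambda>z. of_bool (eq_pm (kap i) (kap j)) * pform (a, b) z) \<in> A3 G n kap"
        unfolding A_eq using 5 by (intro UN_I[of i] UN_I[of j]) auto
      thus ?thesis using pm 5 by (auto dest: one)
    next
      case 6
      have "(\<lambda>z. of_bool (eq_pm (kap i) (kap j)) * pform (a, b) z) \<in> A3 G n kap"
        unfolding A_eq using 6 by (intro UN_I[of i] UN_I[of j]) auto
      thus ?thesis using pm 6 by (auto dest: one)
    next
      case 7
      have "pform (a, b) \<in> A4 G t"
      proof (cases "k = l")
        case True
        thus ?thesis using 7 unfolding A_eq by auto
      next
        case False
        hence "k < l" using 7 by simp
        thus ?thesis using 7 unfolding A_eq by blast
      qed
      thus ?thesis by blast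
    next
      case 8
      thus ?thesis unfolding A_eq by blast
    qed
  qed
  thus ?thesis by (auto simp: pivots_def)
qed

text \<open>A sandwich: the pivot forms already span, they lie in \<open>AA\<close>, and
  \<open>AA\<close> consists of cocycles.\<close>

lemma span_AA:
  "LinearCombinations.module.span class_ring (H2 G) (coset (coboundaries2 G) ` AA) = carrier (H2 G)"
proof -
  interpret quotient "cocycles2 G" "coboundaries2 G"
    by unfold_locales (simp_all add: lin_closed_cocycles2 lin_closed_coboundaries2)
  have "V.span (coset (coboundaries2 G) ` pform ` pivots {0,1}) = carrier Q"
  proof -
    have "k mod 2 \<in> {0, 1}" for k :: nat by auto
    hence "V.span (coset (coboundaries2 G) ` pform ` pivots {0,1}) =
        carrier (quotient_space (cocycles2 G \<inter> UNIV) (coboundaries2 G))"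
      using H2_basis(1)[of UNIV "{0,1}"] unfolding Int_UNIV_right lin_closed_def by blast
    thus ?thesis by simp
  qed
  moreover have "V.span (coset (coboundaries2 G) ` pform ` pivots {0,1}) \<subseteq> V.span (coset (coboundaries2 G) ` AA)"
    by (intro V.span_is_monotone image_mono pivots_AA)
  moreover have "V.span (coset (coboundaries2 G) ` AA) \<subseteq> carrier Q"
    using AA_cocycles2 by (intro V.span_is_subset2) (auto simp: carrier_Q)
  ultimately show ?thesis by (simp add: H2_def)
qed

lemma dim_H2_part: "vectorspace.dim class_ring (H2_part G s) = card (pivots {s})"
  using H2_basis(2)[of "parity2 G s" "{s}"] parity2_iff
  by (simp add: H2_part_def lin_closed_parity2)

section \<open>Counting pivots\<close>

text \<open>Each admissible \<open>(i, j)\<close> gives two orbits, those of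
  \<open>(Ev i, Om j)\<close> and \<open>(Ev (m+i), Om j)\<close>; the pairs
  \<open>(D0, Et k)\<close> add \<open>t\<close>.\<close>

lemma card_pivots_1:
  "card (pivots {1}) = 2 * card {(i, j). eq_pm (lam i) (kap j) \<and> 1 \<le> i \<and> i \<le> m \<and> 1 \<le> j \<and> j \<le> n} + t"
proof -
  let ?L = "{(i, j). eq_pm (lam i) (kap j) \<and> 1 \<le> i \<and> i \<le> m \<and> 1 \<le> j \<and> j \<le> n}"
  let ?f = "\<lambda>(i, j). (Ev i, Om j)" and ?g = "\<lambda>(i, j). (Ev (m+i), Om j)" and ?h = "\<lambda>k. (D0, Et k)"
  have fin: "finite ?L" by (rule finite_subset[of _ "{1..m} \<times> {1..n}"]) auto
  have "pivots {1} = ?f ` ?L \<union> ?g ` ?L \<union> ?h ` {1..t}"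
  proof
    show "pivots {1} \<subseteq> ?f ` ?L \<union> ?g ` ?L \<union> ?h ` {1..t}"
      unfolding pivots_def by (auto elim!: shapeE)
    show "?f ` ?L \<union> ?g ` ?L \<union> ?h ` {1..t} \<subseteq> pivots {1}"
      by (auto simp: pivots_def eq_pm_def D0_def)
  qed
  moreover have "card (?f ` ?L \<union> ?g ` ?L \<union> ?h ` {1..t}) = card (?f ` ?L) + card (?g ` ?L) + card (?h ` {1..t})"
    using fin by (subst card_Un_disjoint; (subst card_Un_disjoint)?) auto
  moreover have "card (?f ` ?L) = card ?L" "card (?g ` ?L) = card ?L" "card (?h ` {1..t}) = t"
    by (subst card_image; auto simp: inj_on_def)+
  ultimately show ?thesis by simp
qed

lemma card_ordered_pairs:
  fixes r :: nat
  assumes "\<And>i. P i i"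
  shows "card {(i, j). P i j \<and> 1 \<le> i \<and> i \<le> j \<and> j \<le> r} = card {(i, j). P i j \<and> 1 \<le> i \<and> i < j \<and> j \<le> r} + r"
proof -
  have "finite {(i, j). P i j \<and> 1 \<le> i \<and> i < j \<and> j \<le> r}"
    by (rule finite_subset[of _ "{1..r} \<times> {1..r}"]) auto
  moreover have "{(i, j). P i j \<and> 1 \<le> i \<and> i \<le> j \<and> j \<le> r} =
      {(i, j). P i j \<and> 1 \<le> i \<and> i < j \<and> j \<le> r} \<union> (\<lambda>i. (i, i)) ` {1..r}"
    using assms by (auto simp: le_less)
  moreover have "card ((\<lambda>i. (i, i)) ` {1..r}) = r" by (subst card_image) (auto simp: inj_on_def)
  ultimately show ?thesis by (simp add: card_Un_disjoint disjoint_iff image_iff)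
qed

text \<open>The missing pair is \<open>(r, r)\<close>; writing \<open>+ 1\<close> on the left avoids
  truncated subtraction.\<close>

lemma card_triangle: "card {(k, l). 1 \<le> k \<and> k \<le> l \<and> l \<le> r \<and> k < r} + 1 = r * (r + 1) div 2" if "r \<ge> 1" for r :: nat
proof -
  have total: "card {(k, l). 1 \<le> k \<and> k \<le> l \<and> l \<le> r} = r * (r + 1) div 2" for r :: nat
  proof (induction r)
    case (Suc r)
    let ?A = "{(k, l). 1 \<le> k \<and> k \<le> l \<and> l \<le> r}" and ?B = "(\<lambda>k. (k, Suc r)) ` {1..Suc r}"
    have split: "{(k, l). 1 \<le> k \<and> k \<le> l \<and> l \<le> Suc r} = ?A \<union> ?B"
      by (auto simp: le_Suc_eq)
    have "finite ?A"
      by (rule finite_subset[of _ "{1..r} \<times> {1..r}"]) auto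
    hence "card (?A \<union> ?B) = card ?A + card ?B"
      by (intro card_Un_disjoint) auto
    moreover have "card ?B = Suc r"
      by (subst card_image) (auto simp: inj_on_def)
    ultimately have "card {(k, l). 1 \<le> k \<and> k \<le> l \<and> l \<le> Suc r} = r * (r + 1) div 2 + Suc r"
      unfolding split by (simp only: Suc)
    thus ?case by simp
  qed (simp add: card_eq_0_iff)
  have ins: "{(k, l). 1 \<le> k \<and> k \<le> l \<and> l \<le> r} = insert (r, r) {(k, l). 1 \<le> k \<and> k \<le> l \<and> l \<le> r \<and> k < r}"
    using that by auto
  have "finite {(k, l). 1 \<le> k \<and> k \<le> l \<and> l \<le> r \<and> k < r}"
    by (rule finite_subset[of _ "{1..r} \<times> {1..r}"]) auto
  thus ?thesis using total[of r] unfolding ins by simp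
qed

text \<open>On the diagonal, \<open>kap\<close> contributes \<open>(Om i, Om i)\<close> but not
  \<open>(Om i, Om (n+i))\<close>, so doubling \<open>card ?K'\<close> overcounts by
  \<open>n\<close>. For \<open>lam\<close> only \<open>(Ev i, Ev (m+i))\<close> survives, which
  gives \<open>+ m\<close>, and \<open>- 1\<close> is the omitted \<open>(Et t, Et t)\<close>. The
  subtractions do not truncate, since \<open>card ?K'\<close> is at least \<open>n\<close>.\<close>

lemma card_pivots_0:
  "card (pivots {0}) = 2 * card {(i, j). eq_pm (lam i) (lam j) \<and> 1 \<le> i \<and> i < j \<and> j \<le> m}
    + 2 * card {(i, j). eq_pm (kap i) (kap j) \<and> 1 \<le> i \<and> i \<le> j \<and> j \<le> n}
    + t * (t + 1) div 2 + m - 1 - n"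
proof -
  let ?L = "{(i, j). eq_pm (lam i) (lam j) \<and> 1 \<le> i \<and> i < j \<and> j \<le> m}"
  let ?L' = "{(i, j). eq_pm (lam i) (lam j) \<and> 1 \<le> i \<and> i \<le> j \<and> j \<le> m}"
  let ?K = "{(i, j). eq_pm (kap i) (kap j) \<and> 1 \<le> i \<and> i < j \<and> j \<le> n}"
  let ?K' = "{(i, j). eq_pm (kap i) (kap j) \<and> 1 \<le> i \<and> i \<le> j \<and> j \<le> n}"
  let ?T = "{(k, l). 1 \<le> k \<and> k \<le> l \<and> l \<le> t \<and> k < t}"
  let ?a = "\<lambda>(i, j). (Ev i, Ev j)" and ?b = "\<lambda>(i, j). (Ev i, Ev (m+j))"
    and ?c = "\<lambda>(i, j). (Om i, Om j)" and ?d = "\<lambda>(i, j). (Om i, Om (n+j))" and ?e = "\<lambda>(k, l). (Et k, Et l)"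
  have fin: "finite ?L" "finite ?L'" "finite ?K" "finite ?K'" "finite ?T"
    by (rule finite_subset[of _ "{1..max m (max n t)} \<times> {1..max m (max n t)}"]; auto)+
  have refl: "eq_pm x x" for x :: 'a by (simp add: eq_pm_def)
  have "pivots {0} = ?a ` ?L \<union> ?b ` ?L' \<union> ?c ` ?K' \<union> ?d ` ?K \<union> ?e ` ?T"
  proof
    show "pivots {0} \<subseteq> ?a ` ?L \<union> ?b ` ?L' \<union> ?c ` ?K' \<union> ?d ` ?K \<union> ?e ` ?T"
      unfolding pivots_def by (auto elim!: shapeE)
    show "?a ` ?L \<union> ?b ` ?L' \<union> ?c ` ?K' \<union> ?d ` ?K \<union> ?e ` ?T \<subseteq> pivots {0}"
      by (auto simp: pivots_def refl)
  qed
  moreover have "card (?a ` ?L \<union> ?b ` ?L' \<union> ?c ` ?K' \<union> ?d ` ?K \<union> ?e ` ?T) =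
      card (?a ` ?L) + card (?b ` ?L') + card (?c ` ?K') + card (?d ` ?K) + card (?e ` ?T)"
  proof -
    have "card (?a ` ?L \<union> ?b ` ?L') = card (?a ` ?L) + card (?b ` ?L')"
      by (rule card_Un_disjoint) (use fin in auto)
    moreover have "card (?a ` ?L \<union> ?b ` ?L' \<union> ?c ` ?K') = card (?a ` ?L \<union> ?b ` ?L') + card (?c ` ?K')"
      by (rule card_Un_disjoint) (use fin in auto)
    moreover have "card (?a ` ?L \<union> ?b ` ?L' \<union> ?c ` ?K' \<union> ?d ` ?K) = card (?a ` ?L \<union> ?b ` ?L' \<union> ?c ` ?K') + card (?d ` ?K)"
      by (rule card_Un_disjoint) (use fin in auto)
    moreover have "card (?a ` ?L \<union> ?b ` ?L' \<union> ?c ` ?K' \<union> ?d ` ?K \<union> ?e ` ?T) =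
        card (?a ` ?L \<union> ?b ` ?L' \<union> ?c ` ?K' \<union> ?d ` ?K) + card (?e ` ?T)"
      by (rule card_Un_disjoint) (use fin in auto)
    ultimately show ?thesis by simp
  qed
  moreover have "card (?a ` ?L) = card ?L" "card (?b ` ?L') = card ?L'" "card (?c ` ?K') = card ?K'"
    "card (?d ` ?K) = card ?K" "card (?e ` ?T) = card ?T"
    by (subst card_image; auto simp: inj_on_def)+
  moreover have "card ?L' = card ?L + m" "card ?K' = card ?K + n"
    using card_ordered_pairs[of "\<lambda>i j. eq_pm (lam i) (lam j)" m] card_ordered_pairs[of "\<lambda>i j. eq_pm (kap i) (kap j)" n]
    by (simp_all add: refl)
  ultimately show ?thesis using card_triangle[OF t] by simp
qed

end

text \<open>The even dimension carries the term \<open>- n\<close>, which the English formula for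
  d_0 does not have: the second form of \<open>A3\<close> is zero for \<open>i = j\<close>, so each
  of the \<open>n\<close> diagonal pairs counts once and not twice.\<close>

theorem theorem4p3:
  fixes lam kap :: "nat \<Rightarrow> 'a::alg_closed_field"
    and p m n t :: nat
    and h :: "(hidx, 'a) based_superalgebra"
    and A :: "((hidx \<Rightarrow> 'a) \<times> (hidx \<Rightarrow> 'a) \<Rightarrow> 'a) set"
  assumes "CHAR('a) = p" and "p > 2"
    and "m \<ge> 1" and "n \<ge> 1" and "t \<ge> 1"
    and "\<forall>i\<in>{1..m}. lam i \<noteq> 0" and "\<forall>j\<in>{1..n}. kap j \<noteq> 0"
    and "\<exists>c. (\<forall>i\<in>{1..m}. lam i ^ (p - 1) = c) \<and> (\<forall>j\<in>{1..n}. kap j ^ (p - 1) = c)"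
    and "h = twisted_heisenberg m n t lam kap"
    and "A = A1 h m lam \<union> A2 h m n lam kap \<union> A3 h n kap \<union> A4 h t \<union> A5 h m t"
  shows
    "dual1 h (Ev (2*m+2)) \<in> cocycles1 h \<inter> parity1 h 0 \<and>
     (\<forall>k\<in>{1..t}. dual1 h (Et k) \<in> cocycles1 h \<inter> parity1 h 1) \<and>
     LinearCombinations.module.span class_ring (H1 h)
       (coset (coboundaries1 h) ` ({dual1 h (Ev (2*m+2))} \<union> {dual1 h (Et k) | k. k \<in> {1..t}}))
       = carrier (H1 h) \<and>
     A \<subseteq> cocycles2 h \<and>
     LinearCombinations.module.span class_ring (H2 h) (coset (coboundaries2 h) ` A) = carrier (H2 h) \<and>
     sdim_H2 h =
       (2 * card {(i, j). eq_pm (lam i) (lam j) \<and> 1 \<le> i \<and> i < j \<and> j \<le> m}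
        + 2 * card {(i, j). eq_pm (kap i) (kap j) \<and> 1 \<le> i \<and> i \<le> j \<and> j \<le> n}
        + t * (t + 1) div 2 + m - 1 - n,
        2 * card {(i, j). eq_pm (lam i) (kap j) \<and> 1 \<le> i \<and> i \<le> m \<and> 1 \<le> j \<and> j \<le> n} + t)"
proof -
  have "(2::'a) \<noteq> 0"
    using assms(1,2) of_nat_eq_0_iff_char_dvd[of 2, where ?'a = 'a] by (auto dest: dvd_imp_le)
  then interpret heisenberg m n t lam kap
    using assms by unfold_locales auto
  have h: "h = G" and A: "A = AA" using assms(9,10) by auto
  have H1: "{dual1 G (Ev (2*m+2))} \<union> {dual1 G (Et k) | k. k \<in> {1..t}} = dual1 G ` insert D0 (Et ` {1..t})"
    by (auto simp: D0_def)
  have par: "dual1 G b \<in> parity1 G (hdeg b)" for b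
    by (auto simp: parity1_def dual1_def hom_vecs_def)
  have "dual1 G (Ev (2*m+2)) \<in> cocycles1 G \<inter> parity1 G 0"
    using H1_basis(2)[of D0] par[of D0] by (simp add: D0_def)
  moreover have "\<forall>k\<in>{1..t}. dual1 G (Et k) \<in> cocycles1 G \<inter> parity1 G 1"
    using H1_basis(2) par[of "Et _"] by simp
  moreover have "sdim_H2 G = (card (pivots {0}), card (pivots {1}))"
    by (simp add: sdim_H2_def dim_H2_part)
  ultimately show ?thesis
    unfolding h A H1 using H1_basis(3) AA_cocycles2 span_AA card_pivots_0 card_pivots_1 by simp
qed

end
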